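(* Let $k\ge 2$ be an integer. The following are equivalent for a tree $T$ of order $n$: (i) $\zeta_k(T) = \frac{n}{k+1}$; (ii) $\zeta_k^i(T) = \frac{n}{k+1}$; (iii) $T\in\mathcal{T}_k$.
   Context: Graphs are finite and simple; the order of a graph is its number of vertices, and trees have at least one vertex. For a graph $G$ and $S\subseteq V(G)$, $N[S]$ denotes $S$ together with all vertices adjacent to a vertex of $S$. A set $S\subseteq V(G)$ (possibly empty) is an all-$k$-isolating set of $G$ if $G-N[S]$ has no component of order at least $k$. The all-$k$-isolation number $\zeta_k(G)$ is the minimum size of an all-$k$-isolating set of $G$, and $\zeta_k^i(G)$ is the minimum size of an all-$k$-isolating set of $G$ that is also an independent set. The family $\mathcal{T}_k$ consists of all trees obtained as follows: start with any tree $T_0$; for each vertex $v$ of $T_0$, independently introduce a (disjoint) copy of any tree $F_v$ of order $k$ (the trees $F_v$ may differ for different $v$), and add an edge joining $v$ to one vertex of $F_v$. *)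

theory Defs
  imports Complex_Main "Graph_Theory.Graph_Theory"
begin

text \<open>
  Finite simple graphs are the symmetric digraphs \<^locale>\<open>pair_graph\<close>: each edge is
  represented by its two arcs. Every edge then yields a directed cycle of length 2, so the
  library's \<^const>\<open>forest\<close> and \<^const>\<open>tree\<close> do not express acyclicity of an undirected graph;
  the cycles of an undirected graph are the directed cycles of length at least 3.
  The constant \<^const>\<open>Digraph_Component.connected\<close> requires at least one vertex.
\<close>

definition undirected_tree :: "'a pair_pre_digraph \<Rightarrow> bool" where
  "undirected_tree G \<longleftrightarrow> pair_graph G \<and> Digraph_Component.connected (with_proj G) \<and>
     \<not> (\<exists>p. pre_digraph.cycle (with_proj G) p \<and> 3 \<le> length p)"

definition closed_nbhd :: "'a pair_pre_digraph \<Rightarrow> 'a set \<Rightarrow> 'a set" where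
  "closed_nbhd G S = S \<union> {v. \<exists>u\<in>S. u \<rightarrow>\<^bsub>with_proj G\<^esub> v}"

definition independent_set :: "'a pair_pre_digraph \<Rightarrow> 'a set \<Rightarrow> bool" where
  "independent_set G S \<longleftrightarrow> S \<subseteq> pverts G \<and> (\<forall>u\<in>S. \<forall>v\<in>S. \<not> u \<rightarrow>\<^bsub>with_proj G\<^esub> v)"

text \<open>
  In a symmetric digraph, the strongly connected components are the connected components.
\<close>

definition all_isolating :: "nat \<Rightarrow> 'a pair_pre_digraph \<Rightarrow> 'a set \<Rightarrow> bool" where
  "all_isolating k G S \<longleftrightarrow> S \<subseteq> pverts G \<and>
     \<not> (\<exists>C \<in> pre_digraph.sccs (with_proj G \<restriction> (pverts G - closed_nbhd G S)). k \<le> card (verts C))"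

text \<open>
  For a finite simple graph and \<open>k \<ge> 1\<close>, both minima below range over nonempty sets:
  a maximal independent set \<open>S\<close> leaves no vertex outside its closed neighbourhood.
\<close>

definition all_isolation_number :: "nat \<Rightarrow> 'a pair_pre_digraph \<Rightarrow> nat" where
  "all_isolation_number k G = Min {card S | S. all_isolating k G S}"

definition indep_all_isolation_number :: "nat \<Rightarrow> 'a pair_pre_digraph \<Rightarrow> nat" where
  "indep_all_isolation_number k G =
     Min {card S | S. all_isolating k G S \<and> independent_set G S}"

definition attach_graphs ::
    "'a pair_pre_digraph \<Rightarrow> ('a \<Rightarrow> 'a pair_pre_digraph) \<Rightarrow> ('a \<Rightarrow> 'a) \<Rightarrow> 'a pair_pre_digraph" where
  "attach_graphs T0 F a = \<lparr>
     pverts = pverts T0 \<union> (\<Union>v\<in>pverts T0. pverts (F v)),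
     parcs = parcs T0 \<union> (\<Union>v\<in>pverts T0. parcs (F v) \<union> {(v, a v), (a v, v)}) \<rparr>"

text \<open>
  The pieces are actual subgraphs of the resulting graph, with disjointness imposed on their
  vertex sets, so the family contains, over the vertex type \<^typ>\<open>'a\<close>, every isomorphic copy
  of each of its members.
\<close>

definition attached_trees :: "nat \<Rightarrow> 'a pair_pre_digraph set" where
  "attached_trees k = {attach_graphs T0 F a | T0 F a.
     undirected_tree T0 \<and>
     (\<forall>v\<in>pverts T0. undirected_tree (F v) \<and> card (pverts (F v)) = k \<and>
        a v \<in> pverts (F v) \<and> pverts (F v) \<inter> pverts T0 = {}) \<and>
     (\<forall>v\<in>pverts T0. \<forall>w\<in>pverts T0. v \<noteq> w \<longrightarrow> pverts (F v) \<inter> pverts (F w) = {})}"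

end

theory Submission
  imports Defs
begin

text \<open>
  Every tree of order \<open>n \<noteq> k\<close> has an independent all-\<open>k\<close>-isolating set of size at most
  \<open>n / (k + 1)\<close>. A direct induction that cuts off a piece of the tree fails: whether the cut
  vertex may enter the set depends on whether its neighbor in the remaining tree has been
  chosen. What does induct is the existence of two \<^emph>\<open>disjoint\<close> independent isolating sets
  \<open>S\<close>, \<open>R\<close> with \<open>(card S + card R) * (k + 1) \<le> 2 * n\<close> (\<open>disjoint_isolating_pair\<close>). Choose a
  minimal piece \<open>A\<close> of order greater than \<open>k\<close> that hangs at a single edge \<open>x - p\<close> with
  \<open>x \<in> A\<close> (or \<open>A\<close> is the whole tree). By minimality all branches of \<open>A - x\<close> have at most \<open>k\<close>
  vertices. One way to isolate \<open>A\<close> is to take \<open>x\<close>; another is to take the neighbors of \<open>x\<close> in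
  the branches of order exactly \<open>k\<close>, or one arbitrary neighbor if there is no such branch.
  Since \<open>p\<close> belongs to at most one of the two sets obtained for the rest, \<open>x\<close> can be added to
  one of them and the neighbors to the other, and the total number of new vertices, times
  \<open>k + 1\<close>, is at most \<open>2 * card A\<close>. The smaller of the two sets is the required one.

  If the bound is attained, then for \<open>k \<ge> 2\<close> the count forces \<open>A\<close> to have order \<open>k + 1\<close> and the
  bound to be attained by the rest, which by induction is a tree with attached trees
  of order \<open>k\<close>. In such a tree an optimal independent isolating set can be made to contain any
  prescribed vertex (\<open>decomposition_through\<close>). Applied to \<open>p\<close>, this shows that \<open>A - x\<close> has a
  branch of order \<open>k\<close>, since otherwise nothing has to be added for \<open>A\<close>; so \<open>A\<close> is \<open>x\<close> with a
  tree of order \<open>k\<close> attached. If \<open>p\<close> is in the base tree, then \<open>x\<close> extends the base tree.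
  Otherwise \<open>p\<close> is in an attached tree, and explicit isolating sets containing \<open>x\<close>
  (\<open>attached_leaf_of_tight\<close>) show that the rest is a single base vertex with its attached tree
  and that \<open>p\<close> is a leaf of the rest, so \<open>p\<close> can serve as its base vertex instead.

  Conversely, in a tree with attached trees of order \<open>k\<close> each attached tree, together with its
  base vertex, contains a vertex of every isolating set, which gives the lower bound
  \<open>n / (k + 1)\<close> even without independence (\<open>decomposition_lower_bound\<close>). Since
  for \<open>n \<noteq> k\<close> this is also an upper bound for both numbers, the three conditions are equivalent.
  For \<open>n = k\<close> all three fail, because \<open>k + 1\<close> does not divide \<open>k\<close>.

  The induction runs over connected vertex sets of one fixed adjacency relation, so that
  passing to a subtree changes nothing but the vertex set.
\<close>

section \<open>Connected vertex sets and branches of a forest\<close>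

definition connected_in :: "'a rel \<Rightarrow> 'a set \<Rightarrow> bool" where
  "connected_in E X \<longleftrightarrow> X \<noteq> {} \<and> (\<forall>u\<in>X. \<forall>v\<in>X. (u, v) \<in> rtrancl_on X E)"

text \<open>
  Together with \<open>connected_inI_cut\<close> this characterizes connectedness by cuts, which spares
  most later arguments the construction of paths.
\<close>

lemma connected_in_cut:
  assumes "connected_in E X" "Y \<subseteq> X" "Y \<noteq> {}" "Y \<noteq> X"
  shows "\<exists>y\<in>Y. \<exists>z\<in>X - Y. (y, z) \<in> E"
proof (rule ccontr)
  assume no: "\<not> ?thesis"
  obtain u v where u: "u \<in> Y" and v: "v \<in> X" "v \<notin> Y" using assms by blast
  then have "(u, v) \<in> rtrancl_on X E" using assms unfolding connected_in_def by blast
  then have "v \<in> Y"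
    by (induct rule: rtrancl_on_induct) (use u no in auto)
  then show False using v by simp
qed

lemma connected_in_closed:
  assumes "connected_in E X" "X \<inter> Y \<noteq> {}"
    and "\<And>y z. y \<in> X \<Longrightarrow> y \<in> Y \<Longrightarrow> z \<in> X \<Longrightarrow> (y, z) \<in> E \<Longrightarrow> z \<in> Y"
  shows "X \<subseteq> Y"
  using connected_in_cut[of E X "X \<inter> Y"] assms by blast

lemma connected_inI_cut:
  assumes "X \<noteq> {}"
    and cut: "\<And>Y. Y \<subseteq> X \<Longrightarrow> Y \<noteq> {} \<Longrightarrow> Y \<noteq> X \<Longrightarrow> \<exists>y\<in>Y. \<exists>z\<in>X - Y. (y, z) \<in> E"
  shows "connected_in E X"
  unfolding connected_in_def
proof (intro conjI ballI)
  fix u v assume uv: "u \<in> X" "v \<in> X"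
  let ?Y = "{z. (u, z) \<in> rtrancl_on X E}"
  have sub: "?Y \<subseteq> X" using in_rtrancl_on_in_F by fastforce
  have "?Y = X"
  proof (rule ccontr)
    assume "?Y \<noteq> X"
    then obtain y z where "y \<in> ?Y" "z \<in> X - ?Y" "(y, z) \<in> E"
      using cut[OF sub] uv by blast
    then show False using rtrancl_on_into_rtrancl_on[of u y X E z] by blast
  qed
  then show "(u, v) \<in> rtrancl_on X E" using uv by blast
qed (fact assms(1))

lemma connected_in_singleton: "connected_in E {x}"
  by (auto simp: connected_in_def)

lemma connected_in_mono:
  assumes X: "connected_in E X" and sub: "E \<inter> X \<times> X \<subseteq> E'"
  shows "connected_in E' X"
proof (rule connected_inI_cut)
  show "X \<noteq> {}" using X by (simp add: connected_in_def)
next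
  fix Y assume "Y \<subseteq> X" "Y \<noteq> {}" "Y \<noteq> X"
  then show "\<exists>y\<in>Y. \<exists>z\<in>X - Y. (y, z) \<in> E'"
    using connected_in_cut[OF X, of Y] sub by blast
qed

text \<open>
  For \<open>w \<in> U\<close> and a symmetric relation this is the vertex set of the component of \<open>w\<close> in the
  subgraph induced by \<open>U\<close>.
\<close>

definition branch :: "'a rel \<Rightarrow> 'a set \<Rightarrow> 'a \<Rightarrow> 'a set" where
  "branch E U w = {z. (w, z) \<in> rtrancl_on U E}"

lemma branch_subset: "branch E U w \<subseteq> U"
  using in_rtrancl_on_in_F by (fastforce simp: branch_def)

lemma root_in_branch: "w \<in> U \<Longrightarrow> w \<in> branch E U w"
  by (simp add: branch_def)

lemma branch_closed: "y \<in> branch E U w \<Longrightarrow> z \<in> U \<Longrightarrow> (y, z) \<in> E \<Longrightarrow> z \<in> branch E U w"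
  unfolding branch_def using rtrancl_on_into_rtrancl_on by fastforce

lemma connected_in_subset_branch:
  assumes "connected_in E X" "X \<subseteq> U" "y \<in> X" "y \<in> branch E U w"
  shows "X \<subseteq> branch E U w"
  by (rule connected_in_closed[OF assms(1)]) (use assms in \<open>auto dest: branch_closed\<close>)

text \<open>
  Acyclicity enters only in the following form: two different neighbors of \<open>x\<close> in a connected
  set avoiding \<open>x\<close> would close a cycle through \<open>x\<close>. Vertex sets are not part of the locale,
  since all subtrees of the given tree are treated within the same relation.
\<close>

locale acyclic_graph =
  fixes E :: "'a rel"
  assumes edge_sym: "(x, y) \<in> E \<Longrightarrow> (y, x) \<in> E"
    and irrefl: "(x, x) \<notin> E"
    and unique_neighbor: "connected_in E Y \<Longrightarrow> x \<notin> Y \<Longrightarrow> y \<in> Y \<Longrightarrow> z \<in> Y \<Longrightarrow>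
          (x, y) \<in> E \<Longrightarrow> (x, z) \<in> E \<Longrightarrow> y = z"
begin

lemma connected_in_insert:
  assumes "connected_in E X" "y \<in> X" "(x, y) \<in> E"
  shows "connected_in E (insert x X)"
proof (rule connected_inI_cut)
  fix Y assume Y: "Y \<subseteq> insert x X" "Y \<noteq> {}" "Y \<noteq> insert x X"
  show "\<exists>u\<in>Y. \<exists>z\<in>insert x X - Y. (u, z) \<in> E"
  proof (cases "Y \<inter> X = {} \<or> X \<subseteq> Y")
    case True
    then show ?thesis using Y assms edge_sym[of x y] by blast
  next
    case False
    then show ?thesis using connected_in_cut[OF assms(1), of "Y \<inter> X"] by blast
  qed
qed simp

lemma connected_branch:
  assumes "w \<in> U"
  shows "connected_in E (branch E U w)" (is "connected_in E ?C")
proof -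
  have sym: "sym (rtrancl_on ?C E)" by (rule rtrancl_on_sym, rule symI, rule edge_sym)
  have *: "(w, u) \<in> rtrancl_on ?C E" if "u \<in> ?C" for u
  proof -
    have "(w, u) \<in> rtrancl_on U E" using that by (simp add: branch_def)
    then show ?thesis
    proof (induct rule: rtrancl_on_induct)
      case base then show ?case by (simp add: root_in_branch)
    next
      case (step y z)
      then have "z \<in> ?C" by (auto simp: branch_def intro: rtrancl_on_into_rtrancl_on)
      with step show ?case by (auto intro: rtrancl_on_into_rtrancl_on)
    qed
  qed
  show ?thesis unfolding connected_in_def
  proof (intro conjI ballI)
    show "?C \<noteq> {}" using root_in_branch[OF assms] by blast
    fix u v assume "u \<in> ?C" "v \<in> ?C"
    then show "(u, v) \<in> rtrancl_on ?C E"
      using * symD[OF sym] rtrancl_on_trans[of u w ?C E v] by blast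
  qed
qed

text \<open>
  Nothing is disconnected by removing a part whose only contact with the remainder is \<open>x\<close>: of
  the two sides of a cut of the remainder, the one without \<open>x\<close> has no edge into the removed
  part, so an edge leaving it in \<open>V\<close> crosses the cut.
\<close>

lemma connected_in_prune:
  assumes "connected_in E V" "C \<subseteq> V" "C \<noteq> V"
    and exit: "\<And>c z. c \<in> C \<Longrightarrow> z \<in> V - C \<Longrightarrow> (c, z) \<in> E \<Longrightarrow> z = x"
  shows "connected_in E (V - C)"
proof (rule connected_inI_cut)
  show "V - C \<noteq> {}" using assms by blast
next
  fix Y assume Y: "Y \<subseteq> V - C" "Y \<noteq> {}" "Y \<noteq> V - C"
  define Z where "Z = (if x \<in> Y then V - C - Y else Y)"
  have Z: "Z \<subseteq> V" "Z \<noteq> {}" "Z \<noteq> V" "x \<notin> Z" "Z \<subseteq> V - C"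
    using Y assms unfolding Z_def by (auto split: if_splits)
  then obtain y z where yz: "y \<in> Z" "z \<in> V - Z" "(y, z) \<in> E"
    using connected_in_cut[OF assms(1)] by blast
  then have "z \<notin> C" using exit[of z y] edge_sym[of y z] Z by blast
  then show "\<exists>y\<in>Y. \<exists>z\<in>V - C - Y. (y, z) \<in> E"
    using yz edge_sym[of y z] Y Z_def by (auto split: if_splits)
qed

text \<open>
  The piece \<open>A\<close> of \<open>V\<close> hangs at the single edge from \<open>x \<in> A\<close> to \<open>p\<close> outside. The
  whole of \<open>V\<close> is admitted as a piece, with arbitrary \<open>p\<close>, so that the top of the tree needs
  no separate treatment.
\<close>

definition pendant :: "'a set \<Rightarrow> 'a \<Rightarrow> 'a \<Rightarrow> 'a set \<Rightarrow> bool" where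
  "pendant V x p A \<longleftrightarrow> A \<subseteq> V \<and> x \<in> A \<and> connected_in E A \<and>
     (\<forall>a\<in>A. \<forall>b\<in>V - A. (a, b) \<in> E \<longrightarrow> a = x \<and> b = p) \<and>
     (A \<noteq> V \<longrightarrow> connected_in E (V - A) \<and> p \<in> V - A \<and> (x, p) \<in> E)"

lemma pendant_whole: "connected_in E V \<Longrightarrow> x \<in> V \<Longrightarrow> pendant V x p V"
  by (simp add: pendant_def)

text \<open>
  Descending one step: the branches of a piece at its root are again pieces, now hanging at
  the root. With \<open>x\<close> as the only exit of \<open>A\<close>, no edge joins a branch to the outside of \<open>A\<close>.
\<close>

lemma pendant_branch:
  assumes V: "connected_in E V" and A: "pendant V x p A" and w: "w \<in> A" "(x, w) \<in> E"
  shows "pendant V w x (branch E (A - {x}) w)" (is "pendant V w x ?C")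
proof -
  have wA: "w \<in> A - {x}" using w irrefl by auto
  have C: "?C \<subseteq> A - {x}" "w \<in> ?C" "connected_in E ?C"
    using branch_subset root_in_branch[OF wA] connected_branch[OF wA] by metis+
  have "c = w \<and> b = x" if "c \<in> ?C" "b \<in> V - ?C" "(c, b) \<in> E" for c b
  proof -
    have "b \<notin> A - {x}" using branch_closed[OF that(1) _ that(3)] that by blast
    moreover have "b \<notin> V - A" using A that C unfolding pendant_def by blast
    ultimately have "b = x" using that by blast
    moreover have "c = w"
      using unique_neighbor[OF C(3), of x c w] C that w edge_sym[of c b] \<open>b = x\<close> by blast
    ultimately show ?thesis by blast
  qed
  moreover have x: "x \<in> V - ?C" "A \<subseteq> V" using A C unfolding pendant_def by auto
  moreover have "connected_in E (V - ?C)"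
    using connected_in_prune[OF V, of ?C x] calculation C by blast
  ultimately show ?thesis unfolding pendant_def
    using C w edge_sym[of x w] by blast
qed

lemma branch_covers:
  assumes A: "connected_in E A" "x \<in> A" and X: "connected_in E X" "X \<subseteq> A - {x}"
  shows "\<exists>w\<in>A. (x, w) \<in> E \<and> X \<subseteq> branch E (A - {x}) w"
proof -
  obtain y where y: "y \<in> X" using X unfolding connected_in_def by blast
  let ?Y = "branch E (A - {x}) y"
  have Y: "?Y \<subseteq> A - {x}" "y \<in> ?Y" "connected_in E ?Y"
    using branch_subset[of E "A - {x}" y] y X root_in_branch[of y "A - {x}" E]
      connected_branch[of y "A - {x}"] by blast+
  then obtain w b where wb: "w \<in> ?Y" "b \<in> A - ?Y" "(w, b) \<in> E"
    using connected_in_cut[OF A(1), of ?Y] A(2) by blast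
  then have "b = x" using branch_closed[of w E "A - {x}" y b] by blast
  have "X \<subseteq> ?Y" using connected_in_subset_branch[OF X(1,2) y Y(2)] .
  also have "?Y \<subseteq> branch E (A - {x}) w"
    using connected_in_subset_branch[OF Y(3,1) wb(1) root_in_branch] wb(1) Y(1) by blast
  finally show ?thesis using wb \<open>b = x\<close> Y(1) edge_sym[of w b] by blast
qed

text \<open>
  A piece of least order among those of order greater than \<open>m\<close> is the analogue, without
  choosing a root, of a deepest vertex whose subtree has more than \<open>m\<close> vertices.
\<close>

lemma exists_minimal_pendant:
  assumes V: "connected_in E V" "finite V" and m: "m < card V"
  obtains x p A where "pendant V x p A" "m < card A"
    "\<And>w. w \<in> A \<Longrightarrow> (x, w) \<in> E \<Longrightarrow> card (branch E (A - {x}) w) \<le> m"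
proof -
  let ?P = "\<lambda>(x, p, A). pendant V x p A \<and> m < card A"
  obtain x0 where "x0 \<in> V" using V unfolding connected_in_def by blast
  then have "?P (x0, x0, V)" using pendant_whole V m by simp
  then obtain t where t: "?P t" "\<And>s. ?P s \<Longrightarrow> card (snd (snd t)) \<le> card (snd (snd s))"
    using ex_has_least_nat[of ?P _ "\<lambda>s. card (snd (snd s))"] by blast
  obtain x p A where tt: "t = (x, p, A)" by (cases t)
  have A: "pendant V x p A" "m < card A" using t(1) tt by auto
  have "card (branch E (A - {x}) w) \<le> m" if w: "w \<in> A" "(x, w) \<in> E" for w
  proof (rule ccontr)
    assume "\<not> ?thesis"
    then have "?P (w, x, branch E (A - {x}) w)"
      using pendant_branch[OF V(1) A(1) w] by simp
    then have le: "card A \<le> card (branch E (A - {x}) w)" using t(2)[of "(w, x, branch E (A - {x}) w)"] tt by simp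
    have "x \<in> A" "A \<subseteq> V" using A(1) unfolding pendant_def by simp_all
    then have "branch E (A - {x}) w \<subset> A" using branch_subset[of E "A - {x}" w] by blast
    then have "card (branch E (A - {x}) w) < card A"
      using psubset_card_mono[OF finite_subset[OF \<open>A \<subseteq> V\<close> V(2)]] by blast
    then show False using le by simp
  qed
  then show ?thesis using that[OF A] by blast
qed

text \<open>
  The set \<open>W\<close> marks the branches of order exactly \<open>k\<close>, the only obstacles left once \<open>x\<close> is
  dominated. Distinct branches are disjoint by acyclicity, whence the bound on the number of
  marked vertices.
\<close>

lemma heavy_neighbors:
  assumes A: "connected_in E A" "x \<in> A" "finite A"
    and light: "\<And>w. w \<in> A \<Longrightarrow> (x, w) \<in> E \<Longrightarrow> card (branch E (A - {x}) w) \<le> k"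
  obtains W where "W \<subseteq> A - {x}" "\<And>w. w \<in> W \<Longrightarrow> (x, w) \<in> E"
    "\<And>X. connected_in E X \<Longrightarrow> X \<subseteq> A - {x} \<Longrightarrow> k \<le> card X \<Longrightarrow> X \<inter> W \<noteq> {}"
    "\<And>w. w \<in> W \<Longrightarrow> \<exists>C. connected_in E C \<and> C \<subseteq> A - {x} \<and> card C = k \<and> w \<in> C"
    "1 + k * card W \<le> card A"
proof -
  let ?b = "branch E (A - {x})"
  define W where "W = {w \<in> A. (x, w) \<in> E \<and> card (?b w) = k}"
  have Wx: "W \<subseteq> A - {x}" using irrefl unfolding W_def by auto
  have fin: "finite (?b w)" for w using branch_subset[of E "A - {x}" w] A(3) by (meson finite_Diff finite_subset)
  have con: "connected_in E (?b w)" "w \<in> ?b w" if "w \<in> W" for w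
    using connected_branch[of w] root_in_branch[of w] Wx that by blast+
  have "X \<inter> W \<noteq> {}" if X: "connected_in E X" "X \<subseteq> A - {x}" "k \<le> card X" for X
  proof -
    obtain w where w: "w \<in> A" "(x, w) \<in> E" "X \<subseteq> ?b w" using branch_covers[OF A(1,2) X(1,2)] by blast
    then have "X = ?b w" using card_seteq[OF fin, of X w] light[of w] X(3) by simp
    moreover have "w \<in> A - {x}" using w irrefl by auto
    ultimately show ?thesis using w X(3) light[of w] root_in_branch[of w "A - {x}" E] unfolding W_def by auto
  qed
  moreover have "1 + k * card W \<le> card A"
  proof -
    have "finite W" using Wx A(3) by (meson finite_Diff finite_subset)
    have "?b w \<inter> ?b w' = {}" if ww: "w \<in> W" "w' \<in> W" "w \<noteq> w'" for w w'
    proof (rule ccontr)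
      assume "?b w \<inter> ?b w' \<noteq> {}"
      then obtain y where y: "y \<in> ?b w" "y \<in> ?b w'" by blast
      then have "?b w' \<subseteq> ?b w" using connected_in_subset_branch[OF con(1)[OF ww(2)] branch_subset y(2,1)] by blast
      then show False using unique_neighbor[OF con(1)[OF ww(1)], of x w w'] con(2) ww
          branch_subset[of E "A - {x}" w] unfolding W_def by blast
    qed
    then have "card (\<Union>w\<in>W. ?b w) = (\<Sum>w\<in>W. card (?b w))"
      using \<open>finite W\<close> fin by (intro card_UN_disjoint) auto
    also have "\<dots> = k * card W" unfolding W_def by simp
    finally have "k * card W = card (\<Union>w\<in>W. ?b w)" by simp
    also have "\<dots> \<le> card (A - {x})"
      using branch_subset[of E "A - {x}"] A(3) by (intro card_mono) auto
    finally show ?thesis using A(2,3) card_Suc_Diff1[of A x] by linarith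
  qed
  moreover have "\<exists>C. connected_in E C \<and> C \<subseteq> A - {x} \<and> card C = k \<and> w \<in> C" if "w \<in> W" for w
    using con[OF that] that branch_subset[of E "A - {x}" w] unfolding W_def by blast
  moreover have "(x, w) \<in> E" if "w \<in> W" for w using that unfolding W_def by simp
  ultimately show ?thesis using that[of W] Wx by simp
qed

end

section \<open>Small disjoint independent isolating sets\<close>

definition nbhd :: "'a rel \<Rightarrow> 'a set \<Rightarrow> 'a set" where
  "nbhd E S = S \<union> E `` S"

text \<open>
  Components of order at least \<open>k\<close> are replaced by connected sets of order at least \<open>k\<close>, which
  need not be maximal and hence behave well under restriction to subtrees.
\<close>

definition isolates :: "'a rel \<Rightarrow> nat \<Rightarrow> 'a set \<Rightarrow> 'a set \<Rightarrow> bool" where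
  "isolates E k V S \<longleftrightarrow> S \<subseteq> V \<and>
     (\<forall>X. connected_in E X \<and> X \<subseteq> V \<and> X \<inter> nbhd E S = {} \<longrightarrow> card X < k)"

definition independent_in :: "'a rel \<Rightarrow> 'a set \<Rightarrow> bool" where
  "independent_in E S \<longleftrightarrow> (\<forall>u\<in>S. \<forall>v\<in>S. (u, v) \<notin> E)"

lemma nbhd_mono: "S \<subseteq> S' \<Longrightarrow> nbhd E S \<subseteq> nbhd E S'"
  unfolding nbhd_def by blast

lemma in_nbhd: "s \<in> S \<Longrightarrow> s \<in> nbhd E S" "s \<in> S \<Longrightarrow> (s, v) \<in> E \<Longrightarrow> v \<in> nbhd E S"
  unfolding nbhd_def by blast+

text \<open>
  With \<open>t\<close> branches of order \<open>k\<close>, the two ways to isolate a piece of order \<open>a\<close> use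
  \<open>1\<close> and \<open>max 1 t\<close> vertices. For \<open>t \<ge> 2\<close> the claim reduces to \<open>(t - 1) * (k - 1) \<ge> 0\<close>.
\<close>

lemma heavy_branches_bound:
  fixes a k t :: nat
  assumes "k + 1 \<le> a" "1 + k * t \<le> a" "1 \<le> k"
  shows "(max 1 t + 1) * (k + 1) \<le> 2 * a"
proof (cases "t \<le> 1")
  case True
  then show ?thesis using assms by (simp add: max_def)
next
  case False
  then obtain s where s: "t = s + 2" using le_Suc_ex[of 2 t] by auto
  obtain l where l: "k = l + 1" using assms(3) le_Suc_ex[of 1 k] by auto
  show ?thesis using assms unfolding s l by (simp add: algebra_simps)
qed

context acyclic_graph
begin

lemma independent_in_Un:
  assumes "independent_in E S" "independent_in E R" "\<And>s r. s \<in> S \<Longrightarrow> r \<in> R \<Longrightarrow> (s, r) \<notin> E"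
  shows "independent_in E (S \<union> R)"
  unfolding independent_in_def
proof (intro ballI notI)
  fix u v assume "u \<in> S \<union> R" "v \<in> S \<union> R" "(u, v) \<in> E"
  then show False using assms edge_sym[of u v] unfolding independent_in_def by blast
qed

lemma independent_in_insert:
  assumes "independent_in E S" "\<And>s. s \<in> S \<Longrightarrow> (x, s) \<notin> E"
  shows "independent_in E (insert x S)"
  using independent_in_Un[of "{x}" S] assms irrefl by (simp add: independent_in_def)

text \<open>
  An edge between two neighbors of \<open>x\<close> would form a triangle.
\<close>

lemma independent_in_neighbors:
  assumes "\<And>w. w \<in> W \<Longrightarrow> (x, w) \<in> E"
  shows "independent_in E W"
  unfolding independent_in_def
proof (intro ballI notI)
  fix v w assume vw: "v \<in> W" "w \<in> W" "(v, w) \<in> E"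
  have "connected_in E {v, w}" using connected_in_insert[OF connected_in_singleton, of w w v] vw by simp
  then show False using unique_neighbor[of "{v, w}" x v w] assms vw irrefl by blast
qed

text \<open>
  Once \<open>x\<close> is dominated, a connected set avoiding the neighborhood of \<open>S\<close> cannot pass between
  \<open>A\<close> and the rest, so both sides can be checked separately.
\<close>

lemma isolates_glue:
  assumes A: "pendant V x p A" and S: "S \<subseteq> V"
    and heavy: "\<And>X. connected_in E X \<Longrightarrow> X \<subseteq> A - {x} \<Longrightarrow> k \<le> card X \<Longrightarrow> X \<inter> W \<noteq> {}"
    and dom: "x \<in> nbhd E S" "W \<subseteq> nbhd E S"
    and rest: "\<And>X. connected_in E X \<Longrightarrow> X \<subseteq> V - A \<Longrightarrow> X \<inter> nbhd E S = {} \<Longrightarrow> card X < k"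
  shows "isolates E k V S"
  unfolding isolates_def
proof (intro conjI allI impI)
  fix X assume X: "connected_in E X \<and> X \<subseteq> V \<and> X \<inter> nbhd E S = {}"
  then have x: "x \<notin> X" using dom by blast
  show "card X < k"
  proof (cases "X \<inter> A = {}")
    case True
    then show ?thesis using rest X by blast
  next
    case False
    have "X \<subseteq> A"
      by (rule connected_in_closed[of E]) (use X False A x in \<open>unfold pendant_def, blast+\<close>)
    then have "X \<subseteq> A - {x}" "X \<inter> W = {}" using X x dom(2) by blast+
    then show ?thesis using heavy[of X] X by (meson leI)
  qed
qed (fact S)

text \<open>
  If the rest has at most \<open>k\<close> vertices, it suffices to dominate its vertex \<open>p\<close> in addition to
  \<open>x\<close> and \<open>W\<close>. This covers the one order, \<open>k\<close>, for which the bound fails and the induction hypothesis is unavailable.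
\<close>

lemma isolates_root:
  assumes A: "pendant V x p A" "finite V" "card (V - A) \<le> k"
    and heavy: "\<And>X. connected_in E X \<Longrightarrow> X \<subseteq> A - {x} \<Longrightarrow> k \<le> card X \<Longrightarrow> X \<inter> W \<noteq> {}"
    and S: "S \<subseteq> V" "x \<in> nbhd E S" "W \<subseteq> nbhd E S" "A \<noteq> V \<Longrightarrow> p \<in> nbhd E S"
  shows "isolates E k V S"
proof (rule isolates_glue[OF A(1) S(1) heavy S(2,3)])
  fix X assume X: "connected_in E X" "X \<subseteq> V - A" "X \<inter> nbhd E S = {}"
  have "A \<noteq> V" using X unfolding connected_in_def by auto
  then have "p \<in> V - A" using A(1) unfolding pendant_def by blast
  then have "X \<subset> V - A" using S(4) \<open>A \<noteq> V\<close> X by blast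
  then show "card X < k" using psubset_card_mono[of "V - A"] A(2,3) by (meson finite_Diff less_le_trans)
qed

lemma isolating_extend:
  assumes A: "pendant V x p A"
    and heavy: "\<And>X. connected_in E X \<Longrightarrow> X \<subseteq> A - {x} \<Longrightarrow> k \<le> card X \<Longrightarrow> X \<inter> W \<noteq> {}"
    and S: "isolates E k (V - A) S" "independent_in E S"
    and Q: "Q \<subseteq> A" "independent_in E Q" "p \<notin> S \<or> x \<notin> Q"
    and dom: "x \<in> nbhd E (S \<union> Q)" "W \<subseteq> nbhd E (S \<union> Q)"
  shows "isolates E k V (S \<union> Q) \<and> independent_in E (S \<union> Q)"
proof
  have sub: "S \<subseteq> V - A" "A \<subseteq> V" using S A unfolding isolates_def pendant_def by auto
  show "isolates E k V (S \<union> Q)"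
  proof (rule isolates_glue[OF A _ heavy dom])
    show "S \<union> Q \<subseteq> V" using sub Q by blast
    show "card X < k" if "connected_in E X" "X \<subseteq> V - A" "X \<inter> nbhd E (S \<union> Q) = {}" for X
      using S(1) that nbhd_mono[of S "S \<union> Q" E] unfolding isolates_def by blast
  qed
  show "independent_in E (S \<union> Q)"
  proof (intro independent_in_Un S(2) Q(2))
    show "(s, r) \<notin> E" if "s \<in> S" "r \<in> Q" for s r
    proof
      assume "(s, r) \<in> E"
      moreover have "r \<in> A" "s \<in> V - A" using that sub Q by blast+
      ultimately have "r = x" "s = p" using A edge_sym[of s r] unfolding pendant_def by blast+
      then show False using that Q(3) by blast
    qed
  qed
qed

text \<open>
  The alternative to taking \<open>x\<close>: one neighbor of \<open>x\<close> in each branch of order \<open>k\<close>, or any one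
  neighbor if there is no such branch, so that \<open>x\<close> is dominated in either case.
\<close>

lemma dominating_neighbors:
  assumes A: "connected_in E A" "x \<in> A" "finite A" "1 < card A"
    and W: "W \<subseteq> A - {x}" "\<And>w. w \<in> W \<Longrightarrow> (x, w) \<in> E"
  obtains Q where "W \<subseteq> Q" "Q \<subseteq> A - {x}" "x \<in> nbhd E Q" "independent_in E Q" "card Q = max 1 (card W)"
proof -
  have "A \<noteq> {x}" using A(4) by auto
  then obtain w where w: "w \<in> A" "(x, w) \<in> E" "w \<noteq> x"
    using connected_in_cut[OF A(1), of "{x}"] A(2) by blast
  define Q where "Q = (if W = {} then {w} else W)"
  have Q: "Q \<noteq> {}" "\<And>w. w \<in> Q \<Longrightarrow> (x, w) \<in> E"
    using W w unfolding Q_def by (auto split: if_splits)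
  have "finite W" using W(1) A(3) finite_subset by blast
  then have "card Q = max 1 (card W)" unfolding Q_def by (auto simp: max_def card_gt_0_iff Suc_le_eq)
  moreover obtain u where u: "u \<in> Q" using Q(1) by blast
  then have "x \<in> nbhd E Q" using in_nbhd(2)[OF u edge_sym[OF Q(2)[OF u]]] by blast
  moreover have "W \<subseteq> Q" "Q \<subseteq> A - {x}" using W w unfolding Q_def by (auto split: if_splits)
  ultimately show ?thesis using that[of Q] independent_in_neighbors[OF Q(2)] by simp
qed

text \<open>
  Disjointness serves to carry the induction: the vertex \<open>p\<close> of the rest is in at most one of the
  two sets, so \<open>x\<close> can join the other one.
\<close>

theorem disjoint_isolating_pair:
  assumes "connected_in E V" "finite V" "card V \<noteq> k" "1 \<le> k"
  shows "\<exists>S R. S \<inter> R = {} \<and> isolates E k V S \<and> isolates E k V R \<and>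
           independent_in E S \<and> independent_in E R \<and> (card S + card R) * (k + 1) \<le> 2 * card V"
  using assms(1-3)
proof (induction "card V" arbitrary: V rule: less_induct)
  case less
  note V = less.prems
  show ?case
  proof (cases "card V < k")
    case True
    then have "isolates E k V {}" unfolding isolates_def using card_mono[OF V(2)] le_less_trans by blast
    then show ?thesis by (intro exI[of _ "{}"]) (simp add: independent_in_def)
  next
    case False
    then have "k < card V" using V by simp
    obtain x p A where A: "pendant V x p A" "k < card A"
      and light: "\<And>w. w \<in> A \<Longrightarrow> (x, w) \<in> E \<Longrightarrow> card (branch E (A - {x}) w) \<le> k"
      using exists_minimal_pendant[OF V(1,2) \<open>k < card V\<close>] by blast
    have sub: "A \<subseteq> V" "x \<in> A" "connected_in E A"
      and B: "A \<noteq> V \<Longrightarrow> connected_in E (V - A) \<and> p \<in> V - A \<and> (x, p) \<in> E"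
      using A(1) unfolding pendant_def by blast+
    have fin: "finite A" "finite (V - A)" using sub V finite_subset by auto
    have cardV: "card V = card A + card (V - A)"
      using card_Diff_subset[OF fin(1) sub(1)] card_mono[OF V(2) sub(1)] by simp
    obtain W where W: "W \<subseteq> A - {x}" "\<And>w. w \<in> W \<Longrightarrow> (x, w) \<in> E"
      and heavy: "\<And>X. connected_in E X \<Longrightarrow> X \<subseteq> A - {x} \<Longrightarrow> k \<le> card X \<Longrightarrow> X \<inter> W \<noteq> {}"
      and cW: "1 + k * card W \<le> card A"
      using heavy_neighbors[OF sub(3,2) fin(1) light] by metis
    have finW: "finite W" using W(1) fin finite_subset by blast
    have bound: "(max 1 (card W) + 1) * (k + 1) \<le> 2 * card A"
      using heavy_branches_bound[of k "card A" "card W"] A(2) cW assms(4) by simp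
    show ?thesis
    proof (cases "card (V - A) = k")
      case True
      then have "A \<noteq> V" using assms(4) by auto
      note B = B[OF this]
      \<comment> \<open>The rest has order \<open>k\<close> and admits no pair; domination of \<open>p\<close> makes it small enough.\<close>
      let ?S = "{x}" and ?R = "insert p W"
      have "isolates E k V ?S"
        by (rule isolates_root[OF A(1) V(2) _ heavy]) (use B W sub True in \<open>auto simp: nbhd_def\<close>)
      moreover have "isolates E k V ?R"
        by (rule isolates_root[OF A(1) V(2) _ heavy])
          (use B W sub True edge_sym[of x p] in \<open>auto simp: nbhd_def\<close>)
      moreover have "independent_in E ?S" "independent_in E ?R"
        using independent_in_neighbors[of ?R x] W B irrefl by (auto simp: independent_in_def)
      moreover have "(card ?S + card ?R) * (k + 1) \<le> 2 * card V"
      proof -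
        have "card ?R \<le> card W + 1" using finW by (simp add: card_insert_if)
        then have "(card ?S + card ?R) * (k + 1) \<le> (card W + 2) * (k + 1)" by (intro mult_right_mono) simp_all
        also have "\<dots> \<le> (max 1 (card W) + 1) * (k + 1) + (k + 1)"
          by (cases "card W") (simp_all add: max_def)
        also have "\<dots> \<le> 2 * card A + 2 * k" using bound assms(4) by simp
        finally show ?thesis using cardV True by simp
      qed
      moreover have "?S \<inter> ?R = {}" using B W sub by blast
      ultimately show ?thesis by blast
    next
      case False
      obtain S R where IH: "S \<inter> R = {}" "p \<notin> S" "isolates E k (V - A) S" "isolates E k (V - A) R"
          "independent_in E S" "independent_in E R" "(card S + card R) * (k + 1) \<le> 2 * card (V - A)"
      proof (cases "A = V")
        case True
        then have "isolates E k (V - A) {}" using assms(4) unfolding isolates_def connected_in_def by auto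
        then show ?thesis using that[of "{}" "{}"] by (simp add: independent_in_def)
      next
        case False
        have "card (V - A) < card V" using cardV A(2) by simp
        then obtain S R where SR: "S \<inter> R = {}" "isolates E k (V - A) S" "isolates E k (V - A) R"
          "independent_in E S" "independent_in E R" "(card S + card R) * (k + 1) \<le> 2 * card (V - A)"
          using less.hyps[of "V - A"] B[OF False] fin(2) \<open>card (V - A) \<noteq> k\<close> by blast
        show ?thesis
        proof (cases "p \<in> S")
          case True
          \<comment> \<open>The two sets are interchangeable, so \<open>p\<close> may be assumed to lie outside the first.\<close>
          then have "p \<notin> R" "R \<inter> S = {}" using SR(1) by blast+
          then show ?thesis using that[of R S] SR(2-6) by (simp add: add.commute)
        next
          case False
          then show ?thesis using that[of S R] SR by blast
        qed
      qed
      have "1 < card A" using A(2) assms(4) by simp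
      then obtain Q where Q: "W \<subseteq> Q" "Q \<subseteq> A - {x}" "x \<in> nbhd E Q" "independent_in E Q"
          "card Q = max 1 (card W)"
        using dominating_neighbors[OF sub(3,2) fin(1) _ W] by metis
      let ?S = "S \<union> {x}" and ?R = "R \<union> Q"
      have "isolates E k V ?S \<and> independent_in E ?S"
        by (rule isolating_extend[OF A(1) heavy IH(3,5)])
          (use sub W(2) IH(2) irrefl in \<open>auto simp: nbhd_def independent_in_def Image_iff\<close>)
      moreover have "isolates E k V ?R \<and> independent_in E ?R"
        by (rule isolating_extend[OF A(1) heavy IH(4,6)]) (use Q in \<open>auto simp: nbhd_def\<close>)
      moreover have "?S \<inter> ?R = {}" using IH(1,3,4) Q sub unfolding isolates_def by blast
      moreover have "(card ?S + card ?R) * (k + 1) \<le> 2 * card V"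
      proof -
        have "card ?S + card ?R \<le> (card S + card R) + (max 1 (card W) + 1)"
          using card_Un_le[of S "{x}"] card_Un_le[of R Q] Q(5) by simp
        then have "(card ?S + card ?R) * (k + 1) \<le> ((card S + card R) + (max 1 (card W) + 1)) * (k + 1)"
          by (rule mult_right_mono) simp
        also have "\<dots> = (card S + card R) * (k + 1) + (max 1 (card W) + 1) * (k + 1)" by (rule add_mult_distrib)
        also have "\<dots> \<le> 2 * card (V - A) + 2 * card A"
          using bound IH(7) by (rule add_mono[rotated])
        finally show ?thesis using cardV by simp
      qed
      ultimately show ?thesis by blast
    qed
  qed
qed

end

section \<open>Trees with attached trees of order \<open>k\<close>\<close>

text \<open>
  The vertex sets of a tree in the family: a base tree on \<open>V0\<close> and an attached tree of order \<open>k\<close>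
  on \<open>F v\<close> for every \<open>v \<in> V0\<close>. Saying that \<open>(a v, v)\<close> is the only edge leaving \<open>F v\<close> excludes
  all further edges between the parts.
\<close>

definition attached_decomposition ::
    "'a rel \<Rightarrow> nat \<Rightarrow> 'a set \<Rightarrow> 'a set \<Rightarrow> ('a \<Rightarrow> 'a set) \<Rightarrow> ('a \<Rightarrow> 'a) \<Rightarrow> bool" where
  "attached_decomposition E k V V0 F a \<longleftrightarrow>
     connected_in E V0 \<and> V = V0 \<union> (\<Union>v\<in>V0. F v) \<and>
     (\<forall>v\<in>V0. connected_in E (F v) \<and> card (F v) = k \<and> a v \<in> F v \<and> (v, a v) \<in> E \<and> F v \<inter> V0 = {} \<and>
        (\<forall>y\<in>F v. \<forall>z\<in>V - F v. (y, z) \<in> E \<longrightarrow> y = a v \<and> z = v)) \<and>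
     (\<forall>v\<in>V0. \<forall>w\<in>V0. v \<noteq> w \<longrightarrow> F v \<inter> F w = {})"

context acyclic_graph
begin

context
  fixes k V V0 F a
  assumes D: "attached_decomposition E k V V0 F a" and fin: "finite V"
begin

lemma decomposition_base: "connected_in E V0" "V0 \<subseteq> V" "finite V0"
proof -
  show "connected_in E V0" and sub: "V0 \<subseteq> V" using D unfolding attached_decomposition_def by auto
  show "finite V0" using finite_subset[OF sub fin] .
qed

lemma decomposition_part:
  assumes "v \<in> V0"
  shows "F v \<subseteq> V" "finite (F v)" "connected_in E (F v)" "card (F v) = k" "a v \<in> F v" "(v, a v) \<in> E"
    "v \<notin> F v" "F v \<inter> V0 = {}"
    "\<And>y z. y \<in> F v \<Longrightarrow> z \<in> V \<Longrightarrow> z \<notin> F v \<Longrightarrow> (y, z) \<in> E \<Longrightarrow> y = a v \<and> z = v"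
    "\<And>w. w \<in> V0 \<Longrightarrow> v \<noteq> w \<Longrightarrow> F v \<inter> F w = {}"
proof -
  show sub: "F v \<subseteq> V" using D assms unfolding attached_decomposition_def by auto
  show "finite (F v)" using sub fin finite_subset by blast
  have P: "connected_in E (F v) \<and> card (F v) = k \<and> a v \<in> F v \<and> (v, a v) \<in> E \<and> F v \<inter> V0 = {} \<and>
      (\<forall>y\<in>F v. \<forall>z\<in>V - F v. (y, z) \<in> E \<longrightarrow> y = a v \<and> z = v)"
    using D unfolding attached_decomposition_def using assms by (elim conjE) (rule bspec)
  then show "connected_in E (F v)" "card (F v) = k" "a v \<in> F v" "(v, a v) \<in> E" "F v \<inter> V0 = {}"
    by simp_all
  then show "v \<notin> F v" using assms by blast
  show "y = a v \<and> z = v" if "y \<in> F v" "z \<in> V" "z \<notin> F v" "(y, z) \<in> E" for y z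
    using P that by blast
  show "F v \<inter> F w = {}" if "w \<in> V0" "v \<noteq> w" for w
    using D assms that unfolding attached_decomposition_def by simp
qed

lemma decomposition_cover:
  assumes "z \<in> V"
  obtains v where "v \<in> V0" "z \<in> insert v (F v)"
proof -
  have "z \<in> V0 \<union> (\<Union>v\<in>V0. F v)" using D assms unfolding attached_decomposition_def by simp
  then show ?thesis using that by blast
qed

lemma decomposition_card: "card V = (k + 1) * card V0"
proof -
  have "card (\<Union>v\<in>V0. F v) = (\<Sum>v\<in>V0. card (F v))"
    using decomposition_part decomposition_base(3) by (intro card_UN_disjoint) auto
  also have "\<dots> = k * card V0" using decomposition_part(4) by simp
  finally have "card (\<Union>v\<in>V0. F v) = k * card V0" .
  moreover have "V = V0 \<union> (\<Union>v\<in>V0. F v)" using D unfolding attached_decomposition_def by simp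
  moreover have "V0 \<inter> (\<Union>v\<in>V0. F v) = {}" using decomposition_part(8) by blast
  ultimately show ?thesis
    using card_Un_disjoint[of V0 "\<Union>v\<in>V0. F v"] decomposition_base(3) decomposition_part(2) by simp
qed

text \<open>
  If \<open>S\<close> misses both \<open>v\<close> and \<open>F v\<close>, then \<open>S\<close> dominates no vertex of \<open>F v\<close>, as \<open>v\<close> is the only
  outside neighbor of \<open>F v\<close>. So \<open>S\<close> has an element in each of the \<open>card V0\<close> disjoint sets
  \<open>insert v (F v)\<close>.
\<close>

lemma decomposition_lower_bound:
  assumes "isolates E k V S"
  shows "card V0 \<le> card S"
proof -
  have "\<exists>s. s \<in> S \<inter> insert v (F v)" if v: "v \<in> V0" for v
  proof (rule ccontr)
    note P = decomposition_part[OF v]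
    assume no: "\<not> ?thesis"
    have "F v \<inter> nbhd E S = {}"
    proof (rule ccontr)
      assume "F v \<inter> nbhd E S \<noteq> {}"
      then obtain s y where sy: "y \<in> F v" "s \<in> S" "(s, y) \<in> E" using no unfolding nbhd_def by blast
      then have "s = v" using P(9)[of y s] edge_sym[of s y] no assms unfolding isolates_def by blast
      then show False using sy no by blast
    qed
    then have "card (F v) < k" using assms P(1,3) unfolding isolates_def by blast
    then show False using P(4) by simp
  qed
  then obtain f where f: "\<And>v. v \<in> V0 \<Longrightarrow> f v \<in> S \<inter> insert v (F v)" by metis
  have "inj_on f V0"
  proof (rule inj_onI, rule ccontr)
    fix v w assume vw: "v \<in> V0" "w \<in> V0" "f v = f w" "v \<noteq> w"
    then show False using f[of v] f[of w] decomposition_part(8,10)[of v] decomposition_part(8)[of w] by force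
  qed
  moreover have "finite S" using assms fin finite_subset unfolding isolates_def by blast
  ultimately show ?thesis using card_inj_on_le[of f V0 S] f by blast
qed

text \<open>
  A connected set can leave an attached tree only through its base vertex.
\<close>

lemma decomposition_confine:
  assumes X: "connected_in E X" "X \<subseteq> V" "X \<inter> V0 \<subseteq> {v}" and v: "v \<in> V0"
  shows "X \<subseteq> insert v (F v) \<or> (\<exists>w\<in>V0 - {v}. X \<subseteq> F w)"
proof (cases "\<exists>w\<in>V0 - {v}. X \<inter> F w \<noteq> {}")
  case True
  then obtain w where w: "w \<in> V0" "w \<noteq> v" "X \<inter> F w \<noteq> {}" by blast
  have "X \<subseteq> F w"
    by (rule connected_in_closed[OF X(1) w(3)]) (use decomposition_part(9)[OF w(1)] w X in blast)
  then show ?thesis using w by blast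
next
  case False
  have "X \<subseteq> insert v (F v)"
  proof
    fix z assume z: "z \<in> X"
    then obtain w where "w \<in> V0" "z \<in> insert w (F w)" using X(2) decomposition_cover[of z] by blast
    then show "z \<in> insert v (F v)" using z False X(3) by blast
  qed
  then show ?thesis by blast
qed

lemma attachments_inj: "inj_on a V0"
proof (rule inj_onI, rule ccontr)
  fix v w assume "v \<in> V0" "w \<in> V0" "a v = a w" "v \<noteq> w"
  then show False using decomposition_part(5)[of v] decomposition_part(5)[of w] decomposition_part(10)[of v w] by auto
qed

lemma attachments_independent:
  assumes "P \<subseteq> V0"
  shows "independent_in E (a ` P)"
  unfolding independent_in_def
proof (intro ballI notI)
  fix y z assume "y \<in> a ` P" "z \<in> a ` P" "(y, z) \<in> E"
  then obtain u w where uw: "u \<in> V0" "w \<in> V0" "y = a u" "z = a w" "(a u, a w) \<in> E" using assms by blast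
  then have "u \<noteq> w" using irrefl by auto
  then have "a w = u" using decomposition_part[OF uw(1)] decomposition_part[OF uw(2)] uw by blast
  then show False using decomposition_part(5,8)[OF uw(2)] uw(1) by blast
qed

lemma attachment_edge:
  assumes "w \<in> V0" "z \<in> V" "z \<notin> F w" "(z, a w) \<in> E"
  shows "z = w"
  using decomposition_part(9)[OF assms(1) decomposition_part(5)[OF assms(1)] assms(2,3) edge_sym[OF assms(4)]] by simp

text \<open>
  The set consists of \<open>s\<close> and the attachment vertices of all parts other than the one containing
  \<open>s\<close>. These dominate all base vertices except possibly the one in the part of \<open>s\<close>. That part
  has \<open>k + 1\<close> vertices and loses \<open>s\<close> and a neighbor of \<open>s\<close>, so fewer than \<open>k\<close> remain.
\<close>

lemma decomposition_through:
  assumes s: "s \<in> V" and k: "1 \<le> k"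
  obtains S where "isolates E k V S" "independent_in E S" "s \<in> S" "card S = card V0"
proof -
  obtain v where v: "v \<in> V0" "s \<in> insert v (F v)" using decomposition_cover[OF s] by blast
  note P = decomposition_part[OF v(1)]
  define S where "S = insert s (a ` (V0 - {v}))"
  have other: "a w \<in> F w" "s \<notin> insert w (F w)" if "w \<in> V0 - {v}" for w
    using that v P(8) P(10)[of w] decomposition_part(5,8)[of w] by blast+
  have "isolates E k V S"
    unfolding isolates_def
  proof (intro conjI allI impI)
    show "S \<subseteq> V" using s other(1) decomposition_part(1) unfolding S_def by blast
    fix X assume X: "connected_in E X \<and> X \<subseteq> V \<and> X \<inter> nbhd E S = {}"
    have dom: "w \<in> nbhd E S" "a w \<in> nbhd E S" if "w \<in> V0 - {v}" for w
      using in_nbhd(1)[of "a w" S E] in_nbhd(2)[of "a w" S w E] edge_sym[OF decomposition_part(6)[of w]] that decomposition_part(6)[of w] unfolding S_def by blast+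
    have "X \<inter> V0 \<subseteq> {v}" using dom(1) X by blast
    then consider "X \<subseteq> insert v (F v)" | w where "w \<in> V0" "w \<noteq> v" "X \<subseteq> F w"
      using decomposition_confine[of X v] X v(1) by blast
    then show "card X < k"
    proof cases
      case 1
      have con: "connected_in E (insert v (F v))" using connected_in_insert[OF P(3,5,6)] .
      have "insert v (F v) \<noteq> {s}" using P(5,7) by auto
      then obtain t where t: "t \<in> insert v (F v)" "t \<noteq> s" "(s, t) \<in> E"
        using connected_in_cut[OF con, of "{s}"] v(2) by blast
      have "X \<subseteq> insert v (F v) - {s, t}" using 1 X t(3) in_nbhd(1)[of s S E] in_nbhd(2)[of s S t E] unfolding S_def by blast
      then have "card X \<le> card (insert v (F v) - {s, t})" using P(2) by (intro card_mono) simp_all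
      also have "\<dots> = k + 1 - 2" using v(2) t P(2,4,7) by (subst card_Diff_subset) simp_all
      finally show ?thesis using k by simp
    next
      case 2
      then have "X \<subset> F w" using dom(2)[of w] X decomposition_part(5)[of w] by blast
      then show ?thesis using psubset_card_mono decomposition_part(2,4) 2(1) by metis
    qed
  qed
  moreover have "independent_in E S" unfolding S_def
  proof (intro independent_in_insert attachments_independent)
    fix y assume "y \<in> a ` (V0 - {v})"
    then show "(s, y) \<notin> E" using attachment_edge[of _ s] other(2) s by blast
  qed blast
  moreover have "card S = card V0"
  proof -
    have "card (a ` (V0 - {v})) = card (V0 - {v})"
      using attachments_inj by (intro card_image) (auto intro: inj_on_subset)
    moreover have "s \<notin> a ` (V0 - {v})" using other by blast
    ultimately show ?thesis unfolding S_def
      using decomposition_base(3) v(1) card_Suc_Diff1[of V0 v] by simp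
  qed
  ultimately show ?thesis using that[of S] unfolding S_def by blast
qed

end

text \<open>
  Any leaf of a tree of order \<open>k + 1\<close> may serve as a one-vertex base tree.
\<close>

lemma single_decomposition:
  assumes "connected_in E V" "finite V" "card V = k + 1" "1 \<le> k" "p \<in> V" "connected_in E (V - {p})"
  shows "\<exists>a. attached_decomposition E k V {p} (\<lambda>_. V - {p}) a"
proof -
  have "V \<noteq> {p}" using assms by auto
  then obtain w where w: "w \<in> V - {p}" "(p, w) \<in> E"
    using connected_in_cut[OF assms(1), of "{p}"] assms(5) by blast
  have "y = w" if "y \<in> V - {p}" "(y, p) \<in> E" for y
    using unique_neighbor[OF assms(6), of p y w] that w edge_sym[of y p] by blast
  then have "attached_decomposition E k V {p} (\<lambda>_. V - {p}) (\<lambda>_. w)"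
    unfolding attached_decomposition_def
    using assms w connected_in_singleton by auto
  then show ?thesis by blast
qed

lemma extend_decomposition:
  assumes A: "pendant V x p A" "A \<noteq> V" and D: "attached_decomposition E k (V - A) V0 F a" and p: "p \<in> V0"
    and branch: "connected_in E (A - {x})" "card (A - {x}) = k" "w \<in> A - {x}" "(x, w) \<in> E"
  shows "attached_decomposition E k V (insert x V0) (F(x := A - {x})) (a(x := w))"
proof -
  have sub: "A \<subseteq> V" "x \<in> A" "(x, p) \<in> E"
    and exit: "\<And>u b. u \<in> A \<Longrightarrow> b \<in> V - A \<Longrightarrow> (u, b) \<in> E \<Longrightarrow> u = x \<and> b = p"
    using A unfolding pendant_def by blast+
  have V0: "connected_in E V0" "V - A = V0 \<union> (\<Union>v\<in>V0. F v)"
    using D unfolding attached_decomposition_def by simp_all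
  have dF: "F v \<inter> F w = {}" if "v \<in> V0" "w \<in> V0" "v \<noteq> w" for v w
    using D that unfolding attached_decomposition_def by simp
  have P: "connected_in E (F v) \<and> card (F v) = k \<and> a v \<in> F v \<and> (v, a v) \<in> E \<and> F v \<inter> V0 = {}"
    if "v \<in> V0" for v
    using D that unfolding attached_decomposition_def by simp
  have exF: "y = a v \<and> z = v" if "v \<in> V0" "y \<in> F v" "z \<in> V - A - F v" "(y, z) \<in> E" for v y z
    using D that unfolding attached_decomposition_def by (metis (no_types, lifting))
  have x: "x \<notin> V0" and FA: "\<And>v. v \<in> V0 \<Longrightarrow> F v \<inter> A = {}" using V0(2) sub by blast+
  let ?F = "F(x := A - {x})" and ?a = "a(x := w)"
  have cover: "V = insert x V0 \<union> (\<Union>v\<in>insert x V0. ?F v)"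
  proof -
    have "(\<Union>v\<in>insert x V0. ?F v) = (A - {x}) \<union> (\<Union>v\<in>V0. F v)" using x by auto
    moreover have "V = A \<union> (V0 \<union> (\<Union>v\<in>V0. F v))" using sub(1) V0(2)[symmetric] by (simp add: Un_absorb1)
    ultimately show ?thesis using sub(2) by auto
  qed
  have old: "\<forall>y\<in>F v. \<forall>z\<in>V - F v. (y, z) \<in> E \<longrightarrow> y = a v \<and> z = v" if v: "v \<in> V0" for v
  proof (intro ballI impI)
    fix y z assume yz: "y \<in> F v" "z \<in> V - F v" "(y, z) \<in> E"
    have "z \<notin> A"
    proof
      assume "z \<in> A"
      moreover have "y \<in> V - A" using yz(1) v V0(2) by blast
      ultimately have "y = p" using exit[of z y] edge_sym[OF yz(3)] by blast
      then show False using p yz(1) P[OF v] by blast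
    qed
    then show "y = a v \<and> z = v" using exF[OF v yz(1) _ yz(3)] yz(2) by blast
  qed
  have new: "\<forall>y\<in>A - {x}. \<forall>z\<in>V - (A - {x}). (y, z) \<in> E \<longrightarrow> y = w \<and> z = x"
  proof (intro ballI impI)
    fix y z assume yz: "y \<in> A - {x}" "z \<in> V - (A - {x})" "(y, z) \<in> E"
    have "z = x" using exit[of y z] yz by blast
    moreover have "y = w"
      using unique_neighbor[OF branch(1), of x y w] yz branch(3,4) edge_sym[OF yz(3)] \<open>z = x\<close> by blast
    ultimately show "y = w \<and> z = x" by blast
  qed
  have part: "connected_in E (?F v) \<and> card (?F v) = k \<and> ?a v \<in> ?F v \<and> (v, ?a v) \<in> E \<and>
      ?F v \<inter> insert x V0 = {} \<and> (\<forall>y\<in>?F v. \<forall>z\<in>V - ?F v. (y, z) \<in> E \<longrightarrow> y = ?a v \<and> z = v)"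
    if v: "v \<in> insert x V0" for v
  proof (cases "v = x")
    case True
    moreover have "(A - {x}) \<inter> insert x V0 = {}" using V0(2) by blast
    ultimately show ?thesis using branch new by (simp only: fun_upd_same; blast)
  next
    case False
    then have v0: "v \<in> V0" using v by blast
    have "F v \<inter> insert x V0 = {}" using P[OF v0] FA[OF v0] sub(2) by blast
    moreover have "?F v = F v" "?a v = a v" using False by simp_all
    ultimately show ?thesis using P[OF v0] old[OF v0] by (simp only:; blast)
  qed
  have disj: "?F u \<inter> ?F v = {}" if "u \<in> insert x V0" "v \<in> insert x V0" "u \<noteq> v" for u v
    using that dF[of u v] FA[of u] FA[of v] by (cases "u = x"; cases "v = x") auto
  show ?thesis
    unfolding attached_decomposition_def
    by (intro conjI connected_in_insert[OF V0(1) p sub(3)] cover)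
      (rule ballI, rule part, assumption, intro ballI impI, rule disj)
qed

end

section \<open>The trees attaining the bound\<close>

text \<open>
  The counting behind the equality case. Here \<open>a\<close> and \<open>b\<close> are the orders of the piece and of the
  rest, \<open>s\<close> and \<open>r\<close> the sizes of the two sets for the rest, and \<open>t\<close> is the number of branches of
  order \<open>k\<close>. With two or more such branches the count would give \<open>(t - 1) * (k - 1) \<le> 0\<close>, which
  is false for \<open>k \<ge> 2\<close>; for \<open>k = 1\<close> it would be consistent.
\<close>

lemma tight_cut_arith:
  fixes a b k q r s t :: nat
  assumes "2 \<le> k" "k + 1 \<le> a" "1 + k * t \<le> a" "(k + 1) * q = a + b"
    "q \<le> s + 1" "q \<le> r + max 1 t" "(s + r) * (k + 1) \<le> 2 * b"
  shows "t \<le> 1" "a = k + 1" "b = (k + 1) * (q - 1)"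
proof -
  have "2 * q * (k + 1) \<le> (s + 1 + (r + max 1 t)) * (k + 1)"
    using assms(5,6) by (intro mult_right_mono) simp_all
  also have "\<dots> = (s + r) * (k + 1) + (max 1 t + 1) * (k + 1)" by (simp add: algebra_simps)
  also have "\<dots> \<le> 2 * b + (max 1 t + 1) * (k + 1)" using assms(7) by simp
  finally have a: "2 * a \<le> (max 1 t + 1) * (k + 1)" using assms(4) by (simp add: algebra_simps)
  show t: "t \<le> 1"
  proof (rule ccontr)
    assume "\<not> t \<le> 1"
    then obtain u where u: "t = u + 2" using le_Suc_ex[of 2 t] by auto
    obtain l where l: "k = l + 2" using assms(1) le_Suc_ex[of 2 k] by auto
    show False using a assms(3) unfolding u l by (simp add: algebra_simps)
  qed
  then show "a = k + 1" using a assms(2) by (simp add: max_def split: if_splits)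
  then have "b = (k + 1) * q - (k + 1)" using assms(4) by simp
  then show "b = (k + 1) * (q - 1)" by (simp add: diff_mult_distrib2)
qed

context acyclic_graph
begin

text \<open>
  A minimal piece with at least one vertex has no branches and is thus a leaf.
\<close>

lemma exists_leaf:
  assumes "connected_in E V" "finite V" "2 \<le> card V"
  obtains p where "p \<in> V" "connected_in E (V - {p})"
proof -
  have pos: "0 < card V" using assms(3) by simp
  obtain x p A where A: "pendant V x p A"
    and light: "\<And>w. w \<in> A \<Longrightarrow> (x, w) \<in> E \<Longrightarrow> card (branch E (A - {x}) w) \<le> 0"
    by (rule exists_minimal_pendant[OF assms(1,2) pos]) blast
  have sub: "A \<subseteq> V" "x \<in> A" "connected_in E A" using A unfolding pendant_def by blast+
  have "A = {x}"
  proof (rule ccontr)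
    assume "A \<noteq> {x}"
    then obtain w where w: "w \<in> A - {x}" "(x, w) \<in> E"
      using connected_in_cut[OF sub(3), of "{x}"] sub(2) by blast
    have "finite (branch E (A - {x}) w)"
      using branch_subset[of E "A - {x}" w] sub(1) assms(2) by (meson finite_Diff finite_subset)
    then have "branch E (A - {x}) w = {}" using light[of w] w by auto
    then show False using root_in_branch[OF w(1), of E] by blast
  qed
  moreover have "A \<noteq> V" using assms(3) \<open>A = {x}\<close> by auto
  ultimately show ?thesis using that[of x] A sub unfolding pendant_def by blast
qed

text \<open>
  The situation where \<open>A\<close>, a vertex \<open>x\<close> with a tree of order \<open>k\<close> attached, hangs at a vertex \<open>p\<close>
  of an attached tree \<open>F v\<close>. The set of \<open>x\<close> and all attachment vertices except \<open>a v\<close> is too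
  small to be isolating. It leaves fewer than \<open>k\<close> vertices connected everywhere but in
  \<open>insert v (F v) - {p}\<close>, which has exactly \<open>k\<close> vertices and hence is connected. If
  there were another base vertex, one of them would be a neighbor \<open>u\<close> of \<open>v\<close>; then replacing
  \<open>a u\<close> by \<open>u\<close> dominates \<open>v\<close> as well, and the resulting set is isolating but too small.
\<close>

lemma attached_leaf_of_tight:
  assumes A: "pendant V x p A" "A \<noteq> V" and fin: "finite V" and k: "2 \<le> k"
    and D: "attached_decomposition E k (V - A) V0 F a"
    and branch: "card (A - {x}) = k" "w \<in> A - {x}" "(x, w) \<in> E"
    and v: "v \<in> V0" "p \<in> F v"
    and tight: "\<And>S. isolates E k V S \<Longrightarrow> independent_in E S \<Longrightarrow> card V0 < card S"
  shows "V - A = insert v (F v)" "connected_in E (insert v (F v) - {p})"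
proof -
  have sub: "A \<subseteq> V" "x \<in> A" "(x, p) \<in> E"
    and exit: "\<And>u b. u \<in> A \<Longrightarrow> b \<in> V - A \<Longrightarrow> (u, b) \<in> E \<Longrightarrow> u = x \<and> b = p"
    using A unfolding pendant_def by blast+
  have fB: "finite (V - A)" "finite A" using fin sub finite_subset by auto
  note base = decomposition_base[OF D fB(1)]
  note part = decomposition_part[OF D fB(1)]
  note P = part[OF v(1)]
  have pw: "p \<notin> F w" if "w \<in> V0" "w \<noteq> v" for w using P(10)[of w] that v by blast
  have pV0: "p \<notin> V0" using P(8) v by blast
  have ax: "(x, a w) \<notin> E" if "w \<in> V0" "w \<noteq> v" for w
    using exit[OF sub(2), of "a w"] part(1,5)[OF that(1)] pw[OF that] by blast
  have light: "X \<inter> {w} \<noteq> {}" if "connected_in E X" "X \<subseteq> A - {x}" "k \<le> card X" for X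
  proof -
    have "X = A - {x}" using that fB(2) branch(1) by (intro card_seteq) simp_all
    then show ?thesis using branch(2) by blast
  qed
  have iso: "isolates E k V S"
    if "S \<subseteq> V" "x \<in> S"
      "\<And>X. connected_in E X \<Longrightarrow> X \<subseteq> V - A \<Longrightarrow> X \<inter> nbhd E S = {} \<Longrightarrow> card X < k" for S
    by (rule isolates_glue[OF A(1) that(1) light _ _ that(3)])
      (use that(2) branch(3) in_nbhd(1)[of x S E] in_nbhd(2)[of x S w E] in blast)+
  have small: "card X < k" if "w \<in> V0" "X \<subseteq> F w" "y \<in> F w" "y \<notin> X" for X w y
    using psubset_card_mono[of "F w" X] part(2,4)[OF that(1)] that by blast
  have aV: "a ` V0 \<subseteq> V" using part(1,5) by blast
  have dom: "w \<in> nbhd E S" "a w \<in> nbhd E S" if "w \<in> V0" "a w \<in> S" for w S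
    using in_nbhd(1)[of "a w" S E] in_nbhd(2)[of "a w" S w E] edge_sym[OF part(6)[OF that(1)]] that(2) by blast+

  define S where "S = insert x (a ` (V0 - {v}))"
  have "independent_in E S" unfolding S_def
    using independent_in_insert[OF attachments_independent[OF D fB(1)], of "V0 - {v}" x] ax by blast
  moreover have "card S \<le> card V0"
  proof -
    have "card (a ` (V0 - {v})) \<le> card (V0 - {v})" using base(3) by (intro card_image_le) simp
    then show ?thesis using base(3) v(1) card_Suc_Diff1[of V0 v]
      unfolding S_def by (simp add: card_insert_if)
  qed
  ultimately have "\<not> isolates E k V S" using tight[of S] by auto
  moreover have "S \<subseteq> V" "x \<in> S" using sub aV unfolding S_def by blast+
  ultimately obtain X where X: "connected_in E X" "X \<subseteq> V - A" "X \<inter> nbhd E S = {}" "k \<le> card X"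
    using iso[of S] by (meson leI)
  have pX: "p \<notin> X" using X(3) in_nbhd(2)[of x S p E] sub(3) unfolding S_def by blast
  have "X \<inter> V0 \<subseteq> {v}" using X(3) dom(1)[of _ S] unfolding S_def by blast
  then consider "X \<subseteq> insert v (F v)" | w where "w \<in> V0" "w \<noteq> v" "X \<subseteq> F w"
    using decomposition_confine[OF D fB(1) X(1,2) _ v(1)] by blast
  then have Xeq: "X = insert v (F v) - {p}"
  proof cases
    case 1
    have "card (insert v (F v) - {p}) = k" using P(2,4,7) v(2) by simp
    then show ?thesis using 1 pX X(4) P(2) by (intro card_seteq) auto
  next
    case 2
    then have "a w \<notin> X" using dom(2)[of w S] X(3) unfolding S_def by blast
    then show ?thesis using small[OF 2(1,3) part(5)[OF 2(1)]] X(4) by simp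
  qed
  then show "connected_in E (insert v (F v) - {p})" using X(1) by simp

  have "V0 = {v}"
  proof (rule ccontr)
    assume "V0 \<noteq> {v}"
    then obtain u where u: "u \<in> V0" "u \<noteq> v" "(v, u) \<in> E"
      using connected_in_cut[OF base(1), of "{v}"] v(1) by blast
    define R where "R = insert x (insert u (a ` (V0 - {u, v})))"
    have "(u, a w) \<notin> E" if "w \<in> V0 - {u, v}" for w
      using attachment_edge[OF D fB(1), of w u] that u(1) base(2) part(8)[of w] by blast
    then have "independent_in E (insert u (a ` (V0 - {u, v})))"
      using independent_in_insert[OF attachments_independent[OF D fB(1)], of "V0 - {u, v}" u] by blast
    moreover have "(x, u) \<notin> E" using exit[OF sub(2), of u] u(1) base(2) pV0 by blast
    ultimately have "independent_in E R" unfolding R_def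
      using independent_in_insert[of "insert u (a ` (V0 - {u, v}))" x] ax by blast
    moreover have "isolates E k V R"
    proof (rule iso)
      show "R \<subseteq> V" "x \<in> R" using sub aV u(1) base(2) unfolding R_def by blast+
      fix Y assume Y: "connected_in E Y" "Y \<subseteq> V - A" "Y \<inter> nbhd E R = {}"
      have uR: "u \<in> nbhd E R" "v \<in> nbhd E R" "a u \<in> nbhd E R"
        using in_nbhd(1)[of u R E] in_nbhd(2)[of u R _ E] edge_sym[OF u(3)] part(6)[OF u(1)]
        unfolding R_def by blast+
      have pR: "p \<in> nbhd E R" using in_nbhd(2)[of x R p E] sub(3) unfolding R_def by blast
      have oR: "w \<in> nbhd E R \<and> a w \<in> nbhd E R" if "w \<in> V0 - {u, v}" for w
        using dom[of w R] that unfolding R_def by blast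
      have "Y \<inter> V0 = {}" using Y(3) uR oR by blast
      then obtain w where w: "w \<in> V0" "Y \<subseteq> F w"
        using decomposition_confine[OF D fB(1) Y(1,2) _ v(1)] v(1) by blast
      have "\<exists>y. y \<in> F w \<and> y \<notin> Y"
        using w(1) v(2) part(5)[OF w(1)] uR pR oR Y(3) by (cases "w = v") blast+
      then show "card Y < k" using small[OF w] by blast
    qed
    moreover have "card R \<le> card V0"
    proof -
      have "card (V0 - {u, v}) = card V0 - 2" using u(1,2) v(1) base(3) by (subst card_Diff_subset) auto
      moreover have "2 \<le> card V0" using u(1,2) v(1) base(3) card_mono[of V0 "{u, v}"] by auto
      moreover have "card (a ` (V0 - {u, v})) \<le> card (V0 - {u, v})" using base(3) by (intro card_image_le) simp
      moreover have "card R \<le> card (a ` (V0 - {u, v})) + 2" unfolding R_def using base(3) by (simp add: card_insert_if)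
      ultimately show ?thesis by linarith
    qed
    ultimately show False using tight[of R] by simp
  qed
  then show "V - A = insert v (F v)" using D unfolding attached_decomposition_def by auto
qed

text \<open>
  Cutting off a minimal piece of order greater than \<open>k\<close> must lose exactly \<open>k + 1\<close> vertices and one
  unit of the minimum, so the rest is again extremal and the induction applies to it.
\<close>

theorem decomposition_of_tight:
  assumes "connected_in E V" "finite V" "card V = (k + 1) * q" "2 \<le> k"
    "\<And>S. isolates E k V S \<Longrightarrow> independent_in E S \<Longrightarrow> q \<le> card S"
  shows "\<exists>V0 F a. attached_decomposition E k V V0 F a"
  using assms(1-3,5)
proof (induction "card V" arbitrary: V q rule: less_induct)
  case less
  note V = less.prems(1-3) and tight = less.prems(4)
  have "V \<noteq> {}" using V(1) unfolding connected_in_def by blast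
  then have "0 < card V" using V(2) by (simp add: card_gt_0_iff)
  then have q: "1 \<le> q" using V(3) by (cases q) simp_all
  have "(k + 1) * 1 \<le> (k + 1) * q" using q by (rule mult_le_mono2)
  then have "k < card V" using V(3) by simp
  obtain x p A where A: "pendant V x p A" "k < card A"
    and light: "\<And>w. w \<in> A \<Longrightarrow> (x, w) \<in> E \<Longrightarrow> card (branch E (A - {x}) w) \<le> k"
    using exists_minimal_pendant[OF V(1,2) \<open>k < card V\<close>] by blast
  have sub: "A \<subseteq> V" "x \<in> A" "connected_in E A"
    and B: "A \<noteq> V \<Longrightarrow> connected_in E (V - A) \<and> p \<in> V - A \<and> (x, p) \<in> E"
    using A(1) unfolding pendant_def by blast+
  have fin: "finite A" "finite (V - A)" using sub V finite_subset by auto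
  have cardV: "card V = card A + card (V - A)"
    using card_Diff_subset[OF fin(1) sub(1)] card_mono[OF V(2) sub(1)] by simp
  obtain W where W: "W \<subseteq> A - {x}" "\<And>w. w \<in> W \<Longrightarrow> (x, w) \<in> E"
    and heavy: "\<And>X. connected_in E X \<Longrightarrow> X \<subseteq> A - {x} \<Longrightarrow> k \<le> card X \<Longrightarrow> X \<inter> W \<noteq> {}"
    and WC: "\<And>w. w \<in> W \<Longrightarrow> \<exists>C. connected_in E C \<and> C \<subseteq> A - {x} \<and> card C = k \<and> w \<in> C"
    and cW: "1 + k * card W \<le> card A"
    using heavy_neighbors[OF sub(3,2) fin(1) light] by metis
  have q_if_small: "q = 1" if "card (V - A) \<le> k"
  proof -
    have "isolates E k V {x}"
      by (rule isolates_root[OF A(1) V(2) that heavy])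
        (use sub B W(2) in \<open>auto simp: nbhd_def Image_iff\<close>)
    then show ?thesis using tight[of "{x}"] q irrefl by (simp add: independent_in_def)
  qed
  show ?case
  proof (cases "A = V")
    case True
    then have "card V = k + 1" using q_if_small V(3) by simp
    then show ?thesis using exists_leaf[OF V(1,2)] single_decomposition[OF V(1,2)] assms(4)
      by (metis Suc_1 Suc_eq_plus1 add_leD1 le_SucI numeral_2_eq_2 nat_1_add_1)
  next
    case False
    note B = B[OF this]
    have "card (V - A) \<noteq> k"
    proof
      assume "card (V - A) = k"
      then show False using q_if_small V(3) cardV A(2) assms(4) by simp
    qed
    then obtain S R where SR: "p \<notin> S" "isolates E k (V - A) S" "isolates E k (V - A) R"
      "independent_in E S" "independent_in E R" "(card S + card R) * (k + 1) \<le> 2 * card (V - A)"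
    proof -
      obtain S R where "S \<inter> R = {}" "isolates E k (V - A) S" "isolates E k (V - A) R"
        "independent_in E S" "independent_in E R" "(card S + card R) * (k + 1) \<le> 2 * card (V - A)"
        using disjoint_isolating_pair[of "V - A" k] B fin(2) \<open>card (V - A) \<noteq> k\<close> assms(4) by auto
      then show ?thesis using that[of S R] that[of R S] by (metis IntI add.commute empty_iff)
    qed
    have "1 < card A" using A(2) assms(4) by simp
    then obtain Q where Q: "W \<subseteq> Q" "Q \<subseteq> A - {x}" "x \<in> nbhd E Q" "independent_in E Q"
        "card Q = max 1 (card W)"
      using dominating_neighbors[OF sub(3,2) fin(1) _ W] by metis
    have add_root: "q \<le> card S' + 1" if "p \<notin> S'" "isolates E k (V - A) S'" "independent_in E S'" for S'
    proof -
      have "isolates E k V (S' \<union> {x}) \<and> independent_in E (S' \<union> {x})"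
        by (rule isolating_extend[OF A(1) heavy that(2,3)])
          (use sub W(2) that(1) irrefl in \<open>auto simp: nbhd_def independent_in_def Image_iff\<close>)
      then have "q \<le> card (S' \<union> {x})" using tight by blast
      then show ?thesis using card_Un_le[of S' "{x}"] by simp
    qed
    have add_neighbors: "q \<le> card S' + max 1 (card W)"
      if "isolates E k (V - A) S'" "independent_in E S'" for S'
    proof -
      have "isolates E k V (S' \<union> Q) \<and> independent_in E (S' \<union> Q)"
        by (rule isolating_extend[OF A(1) heavy that]) (use Q in \<open>auto simp: nbhd_def\<close>)
      then have "q \<le> card (S' \<union> Q)" using tight by blast
      then show ?thesis using card_Un_le[of S' Q] Q(5) by simp
    qed
    have eqs: "card W \<le> 1" "card A = k + 1" "card (V - A) = (k + 1) * (q - 1)"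
      by (rule tight_cut_arith[OF assms(4) _ cW _ add_root[OF SR(1,2,4)] add_neighbors[OF SR(3,5)] SR(6)];
          use A(2) V(3) cardV in simp)+
    have "q - 1 \<le> card S'" if "isolates E k (V - A) S'" "independent_in E S'" for S'
      using add_neighbors[OF that] eqs(1) by (simp add: max_def split: if_splits)
    moreover have "card (V - A) < card V" using cardV A(2) by simp
    ultimately obtain V0 F a where D: "attached_decomposition E k (V - A) V0 F a"
      using less.hyps[of "V - A" "q - 1"] B fin(2) eqs(3) by blast
    have "(k + 1) * card V0 = (k + 1) * (q - 1)" using decomposition_card[OF D fin(2)] eqs(3) by simp
    then have cardV0: "card V0 = q - 1" by (simp only: mult_cancel1) simp
    \<comment> \<open>Without a branch of order \<open>k\<close>, an optimal set of the rest containing \<open>p\<close> would already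
      isolate everything.\<close>
    have "W \<noteq> {}"
    proof
      assume "W = {}"
      obtain S' where S': "isolates E k (V - A) S'" "independent_in E S'" "p \<in> S'" "card S' = card V0"
        using decomposition_through[OF D fin(2), of p] B assms(4) by auto
      have "isolates E k V (S' \<union> {}) \<and> independent_in E (S' \<union> {})"
        by (rule isolating_extend[OF A(1) heavy S'(1,2)])
          (use S'(3) B edge_sym[of x p] \<open>W = {}\<close> in \<open>auto simp: nbhd_def independent_in_def\<close>)
      then show False using tight[of S'] S'(4) cardV0 q by simp
    qed
    then obtain w where w: "w \<in> W" by blast
    have cA: "card (A - {x}) = k" using eqs(2) sub(2) fin(1) by simp
    have wA: "w \<in> A - {x}" "(x, w) \<in> E" using w W by blast+
    have "connected_in E (A - {x})"
    proof -
      obtain C where C: "connected_in E C" "C \<subseteq> A - {x}" "card C = k" using WC[OF w] by blast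
      then have "C = A - {x}" using cA fin(1) by (intro card_seteq) simp_all
      then show ?thesis using C by simp
    qed
    note extend = extend_decomposition[OF A(1) False _ _ this cA wA]
    show ?thesis
    proof (cases "p \<in> V0")
      case True
      then show ?thesis using extend[OF D] by blast
    next
      case False
      then obtain v where v: "v \<in> V0" "p \<in> F v"
        using decomposition_cover[OF D fin(2), of p] B by blast
      have "card V0 < card S'" if "isolates E k V S'" "independent_in E S'" for S'
        using tight[OF that] cardV0 q by simp
      \<comment> \<open>The rest is re-read as the leaf \<open>p\<close> with the tree on the other vertices attached to it, which
        makes \<open>p\<close> a base vertex.\<close>
      note leaf = attached_leaf_of_tight[OF A(1) \<open>A \<noteq> V\<close> V(2) assms(4) D cA wA v this]
      have "card (V - A) = k + 1"
        using leaf(1) decomposition_part(2,4,7)[OF D fin(2) v(1)] by simp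
      then obtain b where "attached_decomposition E k (V - A) {p} (\<lambda>_. V - A - {p}) b"
        using single_decomposition[of "V - A" k p] B fin(2) assms(4) leaf by auto
      then show ?thesis using extend by blast
    qed
  qed
qed

end

section \<open>Trees as symmetric digraphs\<close>

lemma connected_iff_connected_in:
  assumes "pair_graph G"
  shows "Digraph_Component.connected (with_proj G) \<longleftrightarrow> connected_in (parcs G) (pverts G)"
proof -
  interpret pair_graph G by fact
  have "parcs (mk_symmetric (with_proj G)) = parcs G"
    using arcs_symmetric unfolding parcs_mk_symmetric by auto
  then show ?thesis
    unfolding connected_def strongly_connected_def connected_in_def reachable_def by simp
qed

lemma pawalk_snoc:
  assumes "pcas y p z"
  shows "pcas y (p @ [(z, x)]) x" "pawalk_verts y (p @ [(z, x)]) = pawalk_verts y p @ [x]"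
  using assms by (induct p arbitrary: y) auto

lemma pawalk_verts_subset: "pcas y p z \<Longrightarrow> y \<in> Y \<Longrightarrow> set p \<subseteq> Y \<times> Y \<Longrightarrow> set (pawalk_verts y p) \<subseteq> Y"
  by (induct p arbitrary: y) fastforce+

lemma rtrancl_on_restrict: "rtrancl_on U (E \<inter> U \<times> U) = rtrancl_on U E"
proof (intro equalityI subrelI)
  fix u v assume "(u, v) \<in> rtrancl_on U E"
  then show "(u, v) \<in> rtrancl_on U (E \<inter> U \<times> U)"
    by (induct rule: rtrancl_on_induct) (auto intro: rtrancl_on_into_rtrancl_on)
qed (auto elim: rtrancl_on_mono[rotated 2])

text \<open>
  Passing to the subgraph induced by \<open>Y\<close> yields a path that stays within \<open>Y\<close>.
\<close>

lemma connected_in_distinct_walk: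
  assumes Y: "connected_in E Y" "y \<in> Y" "z \<in> Y"
  obtains p where "pcas y p z" "set p \<subseteq> E \<inter> Y \<times> Y" "distinct (pawalk_verts y p)"
proof -
  let ?H = "\<lparr>pverts = Y, parcs = E \<inter> Y \<times> Y\<rparr>"
  interpret H: pair_wf_digraph ?H by unfold_locales auto
  have "y \<rightarrow>\<^sup>*\<^bsub>with_proj ?H\<^esub> z"
    unfolding reachable_def using Y by (simp add: rtrancl_on_restrict connected_in_def)
  then obtain p where "H.apath y p z" using H.reachable_apath by blast
  then show ?thesis using that[of p] unfolding H.apath_def H.awalk_def by simp
qed

text \<open>
  Two different neighbors \<open>y\<close>, \<open>z\<close> of \<open>x\<close> in a connected set avoiding \<open>x\<close> are joined by a path
  in that set. Together with the two edges at \<open>x\<close> this is a cycle of length at least 3.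
\<close>

lemma undirected_tree_acyclic_graph:
  assumes T: "undirected_tree T"
  shows "acyclic_graph (parcs T)"
proof -
  interpret pair_graph T using T by (simp add: undirected_tree_def)
  show ?thesis
  proof
    show "(x, y) \<in> parcs T \<Longrightarrow> (y, x) \<in> parcs T" for x y by (rule arcs_symmetric)
    show "(x, x) \<notin> parcs T" for x using no_loops' by blast
    fix Y x y z
    assume Y: "connected_in (parcs T) Y" "x \<notin> Y" "y \<in> Y" "z \<in> Y" "(x, y) \<in> parcs T" "(x, z) \<in> parcs T"
    show "y = z"
    proof (rule ccontr)
      assume "y \<noteq> z"
      obtain p where p: "pcas y p z" "set p \<subseteq> parcs T \<inter> Y \<times> Y" "distinct (pawalk_verts y p)"
        using connected_in_distinct_walk[OF Y(1,3,4)] by blast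
      let ?q = "(x, y) # p @ [(z, x)]"
      have "awalk x ?q x"
        unfolding awalk_def using p pawalk_snoc(1)[OF p(1)] Y(5,6) in_arcsD1[OF Y(5)] arcs_symmetric[OF Y(6)] by auto
      moreover have "distinct (tl (pawalk_verts x ?q))"
        using pawalk_snoc(2)[OF p(1)] p(3) pawalk_verts_subset[OF p(1) Y(3)] p(2) Y(2) by auto
      ultimately have "cycle ?q" unfolding cycle_def by auto
      moreover have "p \<noteq> []" using p(1) \<open>y \<noteq> z\<close> by auto
      then have "3 \<le> length ?q" by (cases p) auto
      ultimately show False using T unfolding undirected_tree_def by blast
    qed
  qed
qed

lemma undirected_tree_connected_in:
  assumes "undirected_tree T"
  shows "connected_in (parcs T) (pverts T)" "finite (pverts T)" "parcs T \<subseteq> pverts T \<times> pverts T"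
proof -
  interpret pair_graph T using assms by (simp add: undirected_tree_def)
  show "connected_in (parcs T) (pverts T)"
    using assms connected_iff_connected_in by (auto simp: undirected_tree_def)
  show "finite (pverts T)" by (rule pair_finite_verts)
  show "parcs T \<subseteq> pverts T \<times> pverts T" using in_arcsD1 in_arcsD2 by auto
qed

lemma undirected_tree_induced:
  assumes T: "undirected_tree T" and X: "X \<subseteq> pverts T" "connected_in (parcs T) X"
  shows "undirected_tree \<lparr>pverts = X, parcs = parcs T \<inter> X \<times> X\<rparr>" (is "undirected_tree ?H")
proof -
  interpret pair_graph T using T by (simp add: undirected_tree_def)
  have H: "pair_graph ?H"
  proof
    show "finite (pverts ?H)" using X(1) pair_finite_verts by (simp add: finite_subset)
    show "finite (parcs ?H)" using pair_finite_arcs by simp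
    show "symmetric (with_proj ?H)"
      unfolding symmetric_def using arcs_symmetric by (auto intro: symI)
    show "e \<in> parcs ?H \<Longrightarrow> fst e \<noteq> snd e" for e using pair_no_loops by auto
  qed auto
  interpret H: pair_graph ?H by fact
  have "connected_in (parcs ?H) (pverts ?H)"
    using X(2) by (simp add: connected_in_mono)
  moreover have "cycle p" if "H.cycle p" for p
    using that X(1) unfolding cycle_def H.cycle_def awalk_def H.awalk_def by auto
  ultimately show ?thesis
    using T H connected_iff_connected_in[OF H] unfolding undirected_tree_def by blast
qed

text \<open>
  A strongly connected component of a symmetric graph is a connected vertex set, and conversely
  every connected set is contained in the component of each of its vertices.
\<close>

lemma large_scc_iff:
  assumes T: "undirected_tree T" and U: "U \<subseteq> pverts T"
  shows "(\<exists>C \<in> pre_digraph.sccs (with_proj T \<restriction> U). k \<le> card (verts C)) \<longleftrightarrow>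
    (\<exists>X. connected_in (parcs T) X \<and> X \<subseteq> U \<and> k \<le> card X)"
proof -
  interpret pair_graph T using T by (simp add: undirected_tree_def)
  let ?G = "with_proj T \<restriction> U"
  interpret G: wf_digraph ?G by (rule wellformed_induce_subgraph)
  have ends: "arcs_ends ?G = parcs T \<inter> U \<times> U" by (auto simp: arcs_ends_conv)
  have reach: "u \<rightarrow>\<^sup>*\<^bsub>?G\<^esub> v \<longleftrightarrow> (u, v) \<in> rtrancl_on U (parcs T)" for u v
    unfolding reachable_def ends by (simp add: rtrancl_on_restrict)
  have sym: "sym (rtrancl_on U (parcs T))"
    by (rule rtrancl_on_sym, rule symI, rule arcs_symmetric)
  show ?thesis
  proof
    assume "\<exists>C \<in> G.sccs. k \<le> card (verts C)"
    then obtain C where C: "C \<in> G.sccs" "k \<le> card (verts C)" by blast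
    then have ind: "subgraph C ?G" "strongly_connected C"
      by (auto simp: G.sccs_def dest: induced_imp_subgraph)
    have "arcs_ends C \<subseteq> parcs T" "verts C \<subseteq> U"
      using arcs_ends_mono[OF ind(1)] ends subgraph_imp_subverts[OF ind(1)] by auto
    moreover have "connected_in (parcs T) (verts C)"
      using ind(2) rtrancl_on_mono[OF calculation(1) order_refl]
      unfolding strongly_connected_def connected_in_def reachable_def by blast
    ultimately show "\<exists>X. connected_in (parcs T) X \<and> X \<subseteq> U \<and> k \<le> card X" using C(2) by blast
  next
    assume "\<exists>X. connected_in (parcs T) X \<and> X \<subseteq> U \<and> k \<le> card X"
    then obtain X x where X: "connected_in (parcs T) X" "X \<subseteq> U" "k \<le> card X" "x \<in> X"
      unfolding connected_in_def by blast
    let ?S = "branch (parcs T) U x"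
    have x: "x \<in> ?S" using X(2,4) by (auto intro: root_in_branch)
    have "u \<rightarrow>\<^sup>*\<^bsub>?G\<^esub> v" if "u \<in> ?S" "v \<in> ?S" for u v
      using that symD[OF sym, of x u] rtrancl_on_trans[of u x U "parcs T" v] unfolding reach branch_def by blast
    moreover have "\<not> u \<rightarrow>\<^sup>*\<^bsub>?G\<^esub> v" if "u \<in> ?S" "v \<notin> ?S" for u v
      using that rtrancl_on_trans[of x u U "parcs T" v] unfolding reach branch_def by blast
    ultimately have "?S \<in> G.sccs_verts" unfolding G.sccs_verts_def using x by blast
    then have "?S \<in> verts ` G.sccs" using G.sccs_verts_conv by simp
    moreover have "k \<le> card ?S"
    proof -
      have "X \<subseteq> ?S" using connected_in_subset_branch[OF X(1,2,4) x] .
      moreover have "finite ?S" using branch_subset[of "parcs T" U x] U pair_finite_verts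
        by (meson finite_subset)
      ultimately show ?thesis using X(3) card_mono[of ?S X] by linarith
    qed
    ultimately show "\<exists>C \<in> G.sccs. k \<le> card (verts C)" by auto
  qed
qed

lemma all_isolating_iff_isolates:
  assumes T: "undirected_tree T"
  shows "all_isolating k T S \<longleftrightarrow> isolates (parcs T) k (pverts T) S"
proof -
  have nb: "closed_nbhd T S = nbhd (parcs T) S" unfolding closed_nbhd_def nbhd_def by auto
  show ?thesis
    unfolding all_isolating_def isolates_def large_scc_iff[OF T Diff_subset] nb
    by (auto simp: not_le disjoint_iff subset_iff)
qed

text \<open>
  The parts of a decomposition are connected subsets of the tree \<open>T\<close>, so the subgraphs they induce
  are trees. Conversely, the arcs listed by \<open>attach_graphs\<close> leave no second exit from an
  attached tree.
\<close>

lemma attached_trees_iff: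
  assumes T: "undirected_tree T"
  shows "T \<in> attached_trees k \<longleftrightarrow>
    (\<exists>V0 F a. attached_decomposition (parcs T) k (pverts T) V0 F a)"
proof
  assume "T \<in> attached_trees k"
  then obtain T0 F a where TA: "T = attach_graphs T0 F a" and T0: "undirected_tree T0"
    and F: "\<And>v. v \<in> pverts T0 \<Longrightarrow> undirected_tree (F v) \<and> card (pverts (F v)) = k \<and>
        a v \<in> pverts (F v) \<and> pverts (F v) \<inter> pverts T0 = {}"
    and disj: "\<And>v w. v \<in> pverts T0 \<Longrightarrow> w \<in> pverts T0 \<Longrightarrow> v \<noteq> w \<Longrightarrow> pverts (F v) \<inter> pverts (F w) = {}"
    unfolding attached_trees_def by blast
  have verts: "pverts T = pverts T0 \<union> (\<Union>v\<in>pverts T0. pverts (F v))"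
    and arcs: "parcs T = parcs T0 \<union> (\<Union>v\<in>pverts T0. parcs (F v) \<union> {(v, a v), (a v, v)})"
    unfolding TA attach_graphs_def by simp_all
  have con0: "connected_in (parcs T) (pverts T0)"
    by (rule connected_in_mono[OF undirected_tree_connected_in(1)[OF T0]]) (use arcs in blast)
  have con: "connected_in (parcs T) (pverts (F v))" if "v \<in> pverts T0" for v
    by (rule connected_in_mono[OF undirected_tree_connected_in(1)]) (use arcs that F in blast)+
  have exit: "y = a v \<and> z = v"
    if v: "v \<in> pverts T0" and yz: "y \<in> pverts (F v)" "z \<notin> pverts (F v)" "(y, z) \<in> parcs T" for v y z
  proof -
    have y0: "y \<notin> pverts T0" using F[OF v] yz(1) by blast
    have w: "w = v" if "w \<in> pverts T0" "y \<in> pverts (F w)" for w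
      using disj[of v w] v that yz(1) by blast
    have "(y, z) \<notin> parcs T0" using undirected_tree_connected_in(3)[OF T0] y0 by blast
    then obtain u where u: "u \<in> pverts T0" "(y, z) \<in> parcs (F u) \<or> (y, z) = (u, a u) \<or> (y, z) = (a u, u)"
      using yz(3) arcs by blast
    have sub: "parcs (F u) \<subseteq> pverts (F u) \<times> pverts (F u)"
      using undirected_tree_connected_in(3) F[OF u(1)] by blast
    have "y \<in> pverts (F u)" using u sub y0 F[OF u(1)] by blast
    then have "u = v" using w u(1) by blast
    then show ?thesis using u sub y0 yz(2) by blast
  qed
  have edge: "(v, a v) \<in> parcs T" if "v \<in> pverts T0" for v using arcs that by blast
  have part: "connected_in (parcs T) (pverts (F v)) \<and> card (pverts (F v)) = k \<and> a v \<in> pverts (F v) \<and>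
      (v, a v) \<in> parcs T \<and> pverts (F v) \<inter> pverts T0 = {} \<and>
      (\<forall>y\<in>pverts (F v). \<forall>z\<in>pverts T - pverts (F v). (y, z) \<in> parcs T \<longrightarrow> y = a v \<and> z = v)"
    if v: "v \<in> pverts T0" for v
    using con[OF v] F[OF v] edge[OF v] exit[OF v] by blast
  have "attached_decomposition (parcs T) k (pverts T) (pverts T0) (\<lambda>v. pverts (F v)) a"
    unfolding attached_decomposition_def
    by (intro conjI con0 verts) (rule ballI, rule part, assumption, intro ballI impI, rule disj)
  then show "\<exists>V0 F a. attached_decomposition (parcs T) k (pverts T) V0 F a" by blast
next
  assume "\<exists>V0 F a. attached_decomposition (parcs T) k (pverts T) V0 F a"
  then obtain V0 F a where D: "attached_decomposition (parcs T) k (pverts T) V0 F a" by blast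
  interpret acyclic_graph "parcs T" by (rule undirected_tree_acyclic_graph[OF T])
  note tree = undirected_tree_connected_in[OF T]
  note base = decomposition_base[OF D tree(2)]
  note part = decomposition_part[OF D tree(2)]
  define ind where "ind X = \<lparr>pverts = X, parcs = parcs T \<inter> X \<times> X\<rparr>" for X
  have arcs: "parcs T = parcs (ind V0) \<union> (\<Union>v\<in>V0. parcs (ind (F v)) \<union> {(v, a v), (a v, v)})" (is "_ = ?R")
  proof (intro equalityI subrelI)
    fix y z assume yz: "(y, z) \<in> parcs T"
    then have V: "y \<in> pverts T" "z \<in> pverts T" using tree(3) by blast+
    have inner: "(y, z) \<in> ?R" if "v \<in> V0" "y \<in> F v" for v
      using part(9)[OF that V(2) _ yz] that yz by (cases "z \<in> F v") (auto simp: ind_def)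
    have outer: "(y, z) \<in> ?R" if "v \<in> V0" "z \<in> F v" "y \<in> V0" for v
      using part(9)[OF that(1,2) V(1) _ edge_sym[OF yz]] part(8)[OF that(1)] that by auto
    show "(y, z) \<in> ?R"
    proof (cases "y \<in> V0 \<and> z \<in> V0")
      case True
      then show ?thesis using yz by (simp add: ind_def)
    next
      case False
      moreover obtain v where "v \<in> V0" "y \<in> insert v (F v)" using decomposition_cover[OF D tree(2) V(1)] .
      moreover obtain w where "w \<in> V0" "z \<in> insert w (F w)" using decomposition_cover[OF D tree(2) V(2)] .
      ultimately show ?thesis using inner[of v] outer[of w] by blast
    qed
  next
    fix y z assume "(y, z) \<in> ?R"
    then show "(y, z) \<in> parcs T" using part(6) edge_sym[OF part(6)] by (auto simp: ind_def)
  qed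
  have "T = attach_graphs (ind V0) (\<lambda>v. ind (F v)) a"
  proof (rule pair_pre_digraph.equality)
    show "pverts T = pverts (attach_graphs (ind V0) (\<lambda>v. ind (F v)) a)"
      using D unfolding attached_decomposition_def attach_graphs_def ind_def by simp
    show "parcs T = parcs (attach_graphs (ind V0) (\<lambda>v. ind (F v)) a)"
      using arcs unfolding attach_graphs_def by (simp add: ind_def)
  qed simp
  moreover have "undirected_tree (ind V0)"
    unfolding ind_def by (rule undirected_tree_induced[OF T base(2,1)])
  moreover have "undirected_tree (ind (F v))" if "v \<in> V0" for v
    unfolding ind_def by (rule undirected_tree_induced[OF T part(1,3)[OF that]])
  ultimately show "T \<in> attached_trees k"
    unfolding attached_trees_def mem_Collect_eq using part(4,5,8,10)
    by (intro exI[of _ "ind V0"] exI[of _ "\<lambda>v. ind (F v)"] exI[of _ a]) (simp add: ind_def)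
qed

theorem theorem3:
  fixes T :: "'a pair_pre_digraph" and k n :: nat
  assumes "2 \<le> k"
    and "undirected_tree T"
    and "card (pverts T) = n"
  shows "(real (all_isolation_number k T) = real n / real (k + 1) \<longleftrightarrow>
            real (indep_all_isolation_number k T) = real n / real (k + 1)) \<and>
         (real (indep_all_isolation_number k T) = real n / real (k + 1) \<longleftrightarrow>
            T \<in> attached_trees k)"
proof -
  let ?V = "pverts T" and ?E = "parcs T"
  interpret acyclic_graph ?E by (rule undirected_tree_acyclic_graph[OF assms(2)])
  note tree = undirected_tree_connected_in[OF assms(2)]
  define Z where "Z = {card S | S. isolates ?E k ?V S}"
  define I where "I = {card S | S. isolates ?E k ?V S \<and> independent_in ?E S}"
  have Z: "all_isolation_number k T = Min Z"
    unfolding all_isolation_number_def Z_def all_isolating_iff_isolates[OF assms(2)] ..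
  have "all_isolating k T S \<and> independent_set T S \<longleftrightarrow> isolates ?E k ?V S \<and> independent_in ?E S" for S
    unfolding all_isolating_iff_isolates[OF assms(2)] independent_set_def independent_in_def isolates_def
    by auto
  then have I: "indep_all_isolation_number k T = Min I"
    unfolding indep_all_isolation_number_def I_def by simp
  have ratio: "real m = real n / real (k + 1) \<longleftrightarrow> m * (k + 1) = n" for m
  proof -
    have "real m = real n / real (k + 1) \<longleftrightarrow> real (m * (k + 1)) = real n"
      by (simp add: field_simps)
    then show ?thesis by (simp only: of_nat_eq_iff)
  qed
  have D_card: "n = (k + 1) * card V0" if "attached_decomposition ?E k ?V V0 F a" for V0 F a
    using decomposition_card[OF that tree(2)] assms(3) by simp
  show ?thesis
  proof (cases "n = k")
    case True
    have "m * (k + 1) \<noteq> k" for m using assms(1) by (cases m) auto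
    then have "m * (k + 1) \<noteq> n" "(k + 1) * m \<noteq> n" for m
      using True by (metis mult.commute)+
    then show ?thesis
      unfolding ratio attached_trees_iff[OF assms(2)] using D_card by metis
  next
    case False
    have bounded: "I \<subseteq> Z" "Z \<subseteq> {..n}"
      unfolding I_def Z_def isolates_def using assms(3) card_mono[OF tree(2)] by auto
    then have fin: "finite Z" "finite I" using finite_subset[of Z "{..n}"] finite_subset[of I Z] by auto
    obtain S R where SR: "isolates ?E k ?V S" "isolates ?E k ?V R" "independent_in ?E S"
      "independent_in ?E R" "(card S + card R) * (k + 1) \<le> 2 * n"
      using disjoint_isolating_pair[OF tree(1,2), of k] False assms(1,3) by auto
    then have in_I: "card S \<in> I" "card R \<in> I" unfolding I_def by blast+
    then have "2 * Min I \<le> card S + card R"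
      using Min_le[OF fin(2) in_I(1)] Min_le[OF fin(2) in_I(2)] by simp
    then have "2 * Min I * (k + 1) \<le> (card S + card R) * (k + 1)" by (rule mult_le_mono1)
    then have upper: "Min I * (k + 1) \<le> n" using SR(5) by simp
    have ZI: "Min Z \<le> Min I" using Min_antimono[OF bounded(1)] in_I fin(1) by blast
    have "Z \<noteq> {}" using in_I bounded by blast
    have "Min I * (k + 1) = n" if "Min Z * (k + 1) = n"
      using mult_le_mono1[OF ZI, of "k + 1"] upper that by simp
    moreover have "T \<in> attached_trees k" if "Min I * (k + 1) = n"
    proof -
      have "Min I \<le> card S" if "isolates ?E k ?V S" "independent_in ?E S" for S
        using that fin(2) unfolding I_def by (intro Min_le) (auto simp: I_def)
      then show ?thesis unfolding attached_trees_iff[OF assms(2)]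
        using decomposition_of_tight[OF tree(1,2) _ assms(1), of "Min I"] that assms(3)
        by (simp add: mult.commute)
    qed
    moreover have "Min Z * (k + 1) = n" if T: "T \<in> attached_trees k"
    proof -
      obtain V0 F a where D: "attached_decomposition ?E k ?V V0 F a"
        using T unfolding attached_trees_iff[OF assms(2)] by blast
      obtain S where "isolates ?E k ?V S" "Min Z = card S"
        using Min_in[OF fin(1) \<open>Z \<noteq> {}\<close>] unfolding Z_def by blast
      then have "card V0 \<le> Min Z" using decomposition_lower_bound[OF D tree(2)] by simp
      then have "n \<le> Min Z * (k + 1)" using D_card[OF D] mult_le_mono1[of "card V0" "Min Z" "k + 1"] by (simp only: mult.commute)
      moreover have "Min Z * (k + 1) \<le> Min I * (k + 1)" using ZI by (rule mult_le_mono1)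
      ultimately show ?thesis using upper by linarith
    qed
    ultimately show ?thesis unfolding Z I ratio by blast
  qed
qed

end
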